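(* Let $F(x)=\sum_{i=1}^mF_i(x)$, $x\in\mathbb R^d$, with $F_i=\frac1n\sum_{j=1}^nf_{ij}$, where the functions $f_{ij}:\mathbb R^d\to\mathbb R$ are differentiable and possibly nonconvex. Suppose that each $F_i$ is $L$-smooth, i.e. $\|\nabla F_i(u)-\nabla F_i(v)\|\le L\|u-v\|$ for all $u,v$; that each $F_i$ is $\hat L$-average smooth, i.e. $\frac1n\sum_{j=1}^n\|\nabla f_{ij}(u)-\nabla f_{ij}(v)\|^2\le\hat L^2\|u-v\|^2$ for all $u,v$; and that the gossip matrices $W(k)$ satisfy the gossip assumption with constant $\chi\ge1$ (see context). Let $b=\frac{\sqrt n\hat L}{L}$, $p=\frac b{n+b}$, and let the number of communications per iteration be $\chi$. Then algorithm GT-PAGE with multi-stage consensus (see context; suitably chosen step size $\eta$) requires $$\mathcal O\left(n+\frac{\sqrt n\hat L\Delta}{\varepsilon^2}\right)\quad\text{and}\quad\mathcal O\left(\frac{\chi L\Delta}{\varepsilon^2}\right)$$ oracle calls per node and communications, respectively, to reach accuracy $\varepsilon$, i.e. $\mathbb E\|\nabla F(\hat x^N)\|^2\le\varepsilon^2$. Here $\hat x^N$ is taken uniformly at random from $\{\bar x^k\}_{k=0}^{N-1}$, $\bar x^k=\frac1m\sum_{i=1}^mx_i^k$, $N$ is the number of iterations, $\Delta=F(x_0)-F^*$, $x_0\in\mathbb R^d$ is the common starting point of all nodes, and $F^*=\inf F$.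
   Context: There are $m$ nodes; node $i$ holds $F_i$ and a copy $x_i\in\mathbb R^d$ of each variable. Algorithm variables are $x=(x_1,\dots,x_m)\in(\mathbb R^d)^m$, and $\mathbf G(x):=(\nabla F_1(x_1),\dots,\nabla F_m(x_m))$. $\|\cdot\|$ is the Euclidean norm, $I_m$ the identity matrix, $\otimes$ the Kronecker product. An oracle call at node $i$ is the evaluation of the gradient of one component $f_{ij}$. Gossip assumption with constant $\chi\ge1$: there are graphs $\mathcal G^k=(\{1,\dots,m\},\mathcal E^k)$, $k=0,1,2,\dots$, and matrices $W(k)\in\mathbb R^{m\times m}$ such that for every $k$: (1) $[W(k)]_{ij}\ne0$ if and only if $(i,j)\in\mathcal E^k$ or $i=j$; (2) $\ker W(k)\supset\{(a_1,\dots,a_m)\in\mathbb R^m:a_1=\dots=a_m\}$; (3) $\mathrm{range}\,W(k)\subset\{a\in\mathbb R^m:\sum_ia_i=0\}$; (4) $\|(W(k)\otimes I_d)x-x\|^2\le(1-\chi^{-1})\|x\|^2$ for all $x\in(\mathbb R^d)^m$ with $\sum_ix_i=0$. Algorithm GT-PAGE (step size $\eta$, minibatch size $b$, probability $p$). Initialize $x^0=(x_0,\dots,x_0)$, $y^0=\mathbf G(x^0)$, and $v^0$ with all $m$ blocks equal to $\frac1m\sum_{i=1}^my_i^0$. For $k=0,1,\dots,N-1$: $x^{k+1}=((I_m-W(k))\otimes I_d)x^k-\eta v^k$; each node $i$ samples a batch $S_i^k$ of $b$ independent indices, each uniform on $\{1,\dots,n\}$, and sets $(\nabla^k)_i=y_i^k+\frac1b\sum_{j\in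 S_i^k}(\nabla f_{ij}(x_i^{k+1})-\nabla f_{ij}(x_i^k))$; $y^{k+1}=\mathbf G(x^{k+1})$ with probability $p$, and $y^{k+1}=\nabla^k$ with probability $1-p$; $v^{k+1}=((I_m-W(k))\otimes I_d)v^k+y^{k+1}-y^k$. Multi-stage consensus: several communications are performed in a row in each iteration, i.e. in iteration $k$ the matrix $W(k)$ is replaced by $W(k;T)=I_m-\prod_{q=kT}^{(k+1)T-1}(I_m-W(q))$ with $T=\lceil\chi\rceil$, at the cost of $T$ communications per iteration.
   Formalization: The O-constants may depend on the number m of nodes (with F the sum of the F_i, m-independent bounds fail); b is rounded up to an integer, the number of communications per iteration is ⌈χ⌉, oracle calls are bounded in expectation, and N=0 is allowed with output x_0. *)

theory Defs
  imports "HOL-Analysis.Analysis" "HOL-Probability.Probability"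
begin

section \<open>Euclidean spaces of arbitrary dimension inside one type\<close>

text \<open>
  The constant in a complexity bound must not depend on the dimension \<open>d\<close>, so \<open>d\<close> has to be
  quantified inside the formula and cannot be a type index. All spaces \<open>\<real>\<^sup>d\<close> are therefore
  taken as subspaces \<open>Rn d\<close> of the type of finitely supported real sequences, with the inner
  product \<open>x \<bullet> y = (\<Sum>i. x\<^sub>i y\<^sub>i)\<close>. On \<open>Rn d\<close> this is the usual Euclidean structure, and on stacked
  vectors of type \<open>rvec ^ 'm\<close> the library norm is the usual Euclidean norm of \<open>(\<real>\<^sup>d)\<^sup>m\<close>.
\<close>

typedef rvec = "{x :: nat \<Rightarrow> real. finite {i. x i \<noteq> 0}}"
  morphisms coord Abs_rvec
  by (rule exI[of _ "\<lambda>_. 0"]) simp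

lemma finite_supp: "finite {i. coord x i \<noteq> 0}"
  using coord[of x] by simp

lemma rvec_eqI: "(\<And>i. coord x i = coord y i) \<Longrightarrow> x = y"
  by (metis coord_inject ext)

instantiation rvec :: real_inner
begin

definition "0 = Abs_rvec (\<lambda>_. 0)"
definition "x + y = Abs_rvec (\<lambda>i. coord x i + coord y i)"
definition "- x = Abs_rvec (\<lambda>i. - coord x i)"
definition "x - y = Abs_rvec (\<lambda>i. coord x i - coord y i)"
definition "r *\<^sub>R x = Abs_rvec (\<lambda>i. r * coord x i)"
definition "inner x y = (\<Sum>i | coord x i \<noteq> 0. coord x i * coord y i)"
definition "norm (x :: rvec) = sqrt (inner x x)"
definition "dist (x :: rvec) y = norm (x - y)"
definition "sgn (x :: rvec) = inverse (norm x) *\<^sub>R x"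
definition "(uniformity :: (rvec \<times> rvec) filter) = (INF e\<in>{0<..}. principal {(x, y). dist x y < e})"
definition "open (U :: rvec set) \<longleftrightarrow>
  (\<forall>x\<in>U. eventually (\<lambda>(x', y). x' = x \<longrightarrow> y \<in> U) uniformity)"

lemma coord_zero [simp]: "coord 0 i = 0"
  by (simp add: zero_rvec_def Abs_rvec_inverse)

lemma coord_add [simp]: "coord (x + y) i = coord x i + coord y i"
proof -
  have "finite {i. coord x i + coord y i \<noteq> 0}"
    by (rule finite_subset[OF _ finite_UnI[OF finite_supp[of x] finite_supp[of y]]]) auto
  then show ?thesis by (simp add: plus_rvec_def Abs_rvec_inverse)
qed

lemma coord_uminus [simp]: "coord (- x) i = - coord x i"
  using finite_supp[of x] by (simp add: uminus_rvec_def Abs_rvec_inverse)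

lemma coord_diff [simp]: "coord (x - y) i = coord x i - coord y i"
proof -
  have "finite {i. coord x i - coord y i \<noteq> 0}"
    by (rule finite_subset[OF _ finite_UnI[OF finite_supp[of x] finite_supp[of y]]]) auto
  then show ?thesis by (simp add: minus_rvec_def Abs_rvec_inverse)
qed

lemma coord_scaleR [simp]: "coord (r *\<^sub>R x) i = r * coord x i"
proof -
  have "finite {i. r * coord x i \<noteq> 0}"
    by (rule finite_subset[OF _ finite_supp[of x]]) auto
  then show ?thesis by (simp add: scaleR_rvec_def Abs_rvec_inverse)
qed

lemma inner_rvec_superset:
  assumes "finite S" "{i. coord x i \<noteq> 0} \<subseteq> S"
  shows "inner x y = (\<Sum>i\<in>S. coord x i * coord y i)"
  unfolding inner_rvec_def by (rule sum.mono_neutral_left) (use assms in auto)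

instance
proof
  fix x y z :: rvec and r s :: real
  show "x + y + z = x + (y + z)" "x + y = y + x" "0 + x = x" "- x + x = 0" "x - y = x + - y"
    "r *\<^sub>R (x + y) = r *\<^sub>R x + r *\<^sub>R y" "(r + s) *\<^sub>R x = r *\<^sub>R x + s *\<^sub>R x"
    "r *\<^sub>R s *\<^sub>R x = (r * s) *\<^sub>R x" "1 *\<^sub>R x = x"
    by (rule rvec_eqI; simp add: algebra_simps)+
  let ?S = "{i. coord x i \<noteq> 0} \<union> {i. coord y i \<noteq> 0}"
  have fin: "finite ?S" using finite_supp by auto
  have supp_add: "{i. coord (x + y) i \<noteq> 0} \<subseteq> ?S" by auto
  have x: "inner x u = (\<Sum>i\<in>?S. coord x i * coord u i)" for u
    by (rule inner_rvec_superset[OF fin]) auto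
  have y: "inner y u = (\<Sum>i\<in>?S. coord y i * coord u i)" for u
    by (rule inner_rvec_superset[OF fin]) auto
  show "inner x y = inner y x"
    by (simp add: x y mult.commute)
  show "inner (x + y) z = inner x z + inner y z"
    by (simp add: inner_rvec_superset[OF fin supp_add] x y distrib_right sum.distrib)
  have supp_scale: "{i. coord (r *\<^sub>R x) i \<noteq> 0} \<subseteq> ?S" by auto
  show "inner (r *\<^sub>R x) y = r * inner x y"
    by (simp add: inner_rvec_superset[OF fin supp_scale] x sum_distrib_left mult.assoc)
  show "0 \<le> inner x x"
    by (simp add: inner_rvec_def sum_nonneg)
  have "inner x x = 0 \<longleftrightarrow> (\<forall>i. coord x i = 0)"
    unfolding inner_rvec_def using finite_supp[of x] by (subst sum_nonneg_eq_0_iff) auto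
  also have "\<dots> \<longleftrightarrow> x = 0"
    using rvec_eqI[of x 0] by auto
  finally show "inner x x = 0 \<longleftrightarrow> x = 0" .
qed (rule norm_rvec_def dist_rvec_def sgn_rvec_def uniformity_rvec_def open_rvec_def)+

end

definition Rn :: "nat \<Rightarrow> rvec set" where
  "Rn d = {x. \<forall>i\<ge>d. coord x i = 0}"

definition grad :: "nat \<Rightarrow> (rvec \<Rightarrow> real) \<Rightarrow> rvec \<Rightarrow> rvec" where
  "grad d f x = (THE g. g \<in> Rn d \<and> (f has_derivative (\<lambda>h. inner g h)) (at x within Rn d))"


section \<open>Objective and smoothness\<close>

text \<open>
  The nodes are the elements of a finite type \<open>'m\<close>; \<open>f i j\<close> is the \<open>j\<close>-th component at node \<open>i\<close>,
  with \<open>j \<in> {1..n}\<close>. Functions on \<open>\<real>\<^sup>d\<close> are only ever looked at on \<open>Rn d\<close>.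
\<close>

definition node_obj :: "nat \<Rightarrow> ('m \<Rightarrow> nat \<Rightarrow> rvec \<Rightarrow> real) \<Rightarrow> 'm \<Rightarrow> rvec \<Rightarrow> real" where
  "node_obj n f i x = (1 / real n) * (\<Sum>j=1..n. f i j x)"

definition obj :: "nat \<Rightarrow> ('m::finite \<Rightarrow> nat \<Rightarrow> rvec \<Rightarrow> real) \<Rightarrow> rvec \<Rightarrow> real" where
  "obj n f x = (\<Sum>i\<in>UNIV. node_obj n f i x)"

definition L_smooth :: "nat \<Rightarrow> real \<Rightarrow> (rvec \<Rightarrow> real) \<Rightarrow> bool" where
  "L_smooth d L F \<longleftrightarrow>
     (\<forall>u\<in>Rn d. \<forall>v\<in>Rn d. norm (grad d F u - grad d F v) \<le> L * norm (u - v))"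

definition avg_smooth :: "nat \<Rightarrow> nat \<Rightarrow> real \<Rightarrow> (nat \<Rightarrow> rvec \<Rightarrow> real) \<Rightarrow> bool" where
  "avg_smooth d n Lh g \<longleftrightarrow>
     (\<forall>u\<in>Rn d. \<forall>v\<in>Rn d.
        (1 / real n) * (\<Sum>j=1..n. (norm (grad d (g j) u - grad d (g j) v))\<^sup>2)
          \<le> Lh\<^sup>2 * (norm (u - v))\<^sup>2)"


section \<open>Gossip matrices\<close>

text \<open>The action of \<open>A \<otimes> I\<^sub>d\<close> on stacked vectors, written blockwise.\<close>

definition kron_apply :: "real ^ 'm ^ 'm \<Rightarrow> rvec ^ 'm \<Rightarrow> rvec ^ ('m::finite)" where
  "kron_apply A x = (\<chi> i. \<Sum>j\<in>UNIV. (A $ i $ j) *\<^sub>R (x $ j))"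

definition gossip ::
  "nat \<Rightarrow> real \<Rightarrow> (nat \<Rightarrow> ('m \<times> 'm) set) \<Rightarrow> (nat \<Rightarrow> real ^ 'm ^ ('m::finite)) \<Rightarrow> bool" where
  "gossip d chi E W \<longleftrightarrow> (\<forall>k.
     (\<forall>i j. W k $ i $ j \<noteq> 0 \<longleftrightarrow> (i, j) \<in> E k \<or> i = j) \<and>
     {a. \<forall>i j. a $ i = a $ j} \<subseteq> {a. W k *v a = 0} \<and>
     range (\<lambda>a. W k *v a) \<subseteq> {a. (\<Sum>i\<in>UNIV. a $ i) = 0} \<and>
     (\<forall>x. (\<forall>i. x $ i \<in> Rn d) \<and> (\<Sum>i\<in>UNIV. x $ i) = 0 \<longrightarrow>
        (norm (kron_apply (W k) x - x))\<^sup>2 \<le> (1 - inverse chi) * (norm x)\<^sup>2))"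

text \<open>
  \<open>consensus_prod W s t\<close> is the product of the matrices \<open>I - W q\<close> for \<open>q = s, \<dots>, s + t - 1\<close>. The
  factors need not commute; they are composed in the order of communication, so that \<open>I - W s\<close> acts
  first.
\<close>

primrec consensus_prod ::
  "(nat \<Rightarrow> real ^ 'm ^ ('m::finite)) \<Rightarrow> nat \<Rightarrow> nat \<Rightarrow> real ^ 'm ^ 'm" where
  "consensus_prod W s 0 = mat 1"
| "consensus_prod W s (Suc t) = (mat 1 - W (s + t)) ** consensus_prod W s t"

definition multi_stage ::
  "(nat \<Rightarrow> real ^ 'm ^ ('m::finite)) \<Rightarrow> nat \<Rightarrow> nat \<Rightarrow> real ^ 'm ^ 'm" where
  "multi_stage W T k = mat 1 - consensus_prod W (k * T) T"


section \<open>The algorithm\<close>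

text \<open>
  \<open>gt_calls\<close> counts the oracle calls made so far by each single node; all nodes make the same number,
  because the coin deciding between the full gradient and the minibatch estimator is shared.
\<close>

record 'm gt_state =
  gt_x :: "rvec ^ 'm"
  gt_y :: "rvec ^ 'm"
  gt_v :: "rvec ^ 'm"
  gt_calls :: nat

definition node_mean :: "rvec ^ ('m::finite) \<Rightarrow> rvec" where
  "node_mean x = (1 / real CARD('m)) *\<^sub>R (\<Sum>i\<in>UNIV. x $ i)"

definition full_grad ::
  "nat \<Rightarrow> nat \<Rightarrow> ('m \<Rightarrow> nat \<Rightarrow> rvec \<Rightarrow> real) \<Rightarrow> rvec ^ 'm \<Rightarrow> rvec ^ ('m::finite)" where
  "full_grad d n f x = (\<chi> i. grad d (node_obj n f i) (x $ i))"

definition gt_page_init ::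
  "nat \<Rightarrow> nat \<Rightarrow> ('m::finite \<Rightarrow> nat \<Rightarrow> rvec \<Rightarrow> real) \<Rightarrow> rvec \<Rightarrow> 'm gt_state" where
  "gt_page_init d n f x0 =
     (let x = (\<chi> i. x0); y = full_grad d n f x
      in \<lparr>gt_x = x, gt_y = y, gt_v = (\<chi> i. node_mean y), gt_calls = n\<rparr>)"

text \<open>
  \<open>S (i, l)\<close> is the \<open>l\<close>-th of the \<open>b\<close> indices sampled by node \<open>i\<close>. Every iteration costs a node
  \<open>2 * b\<close> oracle calls for the minibatch estimator, which is evaluated whatever the coin says, and
  \<open>n\<close> more when the full gradient is taken.
\<close>

definition gt_page_step ::
  "nat \<Rightarrow> nat \<Rightarrow> ('m::finite \<Rightarrow> nat \<Rightarrow> rvec \<Rightarrow> real) \<Rightarrow> real ^ 'm ^ 'm \<Rightarrow> real \<Rightarrow> nat \<Rightarrow> real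
     \<Rightarrow> 'm gt_state \<Rightarrow> 'm gt_state pmf" where
  "gt_page_step d n f W \<eta> b p s =
     bind_pmf (Pi_pmf (UNIV \<times> {..<b}) 0 (\<lambda>_. pmf_of_set {1..n})) (\<lambda>S.
     bind_pmf (bernoulli_pmf p) (\<lambda>coin.
       let x' = kron_apply (mat 1 - W) (gt_x s) - \<eta> *\<^sub>R gt_v s;
           est = (\<chi> i. gt_y s $ i + (1 / real b) *\<^sub>R
                   (\<Sum>l<b. grad d (f i (S (i, l))) (x' $ i) - grad d (f i (S (i, l))) (gt_x s $ i)));
           y' = (if coin then full_grad d n f x' else est)
       in return_pmf
            \<lparr>gt_x = x', gt_y = y',
             gt_v = kron_apply (mat 1 - W) (gt_v s) + y' - gt_y s,
             gt_calls = gt_calls s + 2 * b + (if coin then n else 0)\<rparr>))"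

text \<open>The law of the state after \<open>k\<close> iterations.\<close>

primrec gt_page ::
  "nat \<Rightarrow> nat \<Rightarrow> ('m::finite \<Rightarrow> nat \<Rightarrow> rvec \<Rightarrow> real) \<Rightarrow> (nat \<Rightarrow> real ^ 'm ^ 'm) \<Rightarrow> real \<Rightarrow> nat \<Rightarrow> real
     \<Rightarrow> rvec \<Rightarrow> nat \<Rightarrow> 'm gt_state pmf" where
  "gt_page d n f W \<eta> b p x0 0 = return_pmf (gt_page_init d n f x0)"
| "gt_page d n f W \<eta> b p x0 (Suc k) =
     bind_pmf (gt_page d n f W \<eta> b p x0 k) (gt_page_step d n f (W k) \<eta> b p)"

text \<open>
  The law of the output after \<open>N\<close> iterations. The index is independent of the run, so the law of the
  iterate it selects is the mixture of the laws of the single iterates. When no iteration is made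
  the output is the starting point.
\<close>

definition gt_page_output ::
  "nat \<Rightarrow> nat \<Rightarrow> ('m::finite \<Rightarrow> nat \<Rightarrow> rvec \<Rightarrow> real) \<Rightarrow> (nat \<Rightarrow> real ^ 'm ^ 'm) \<Rightarrow> real \<Rightarrow> nat \<Rightarrow> real
     \<Rightarrow> rvec \<Rightarrow> nat \<Rightarrow> rvec pmf" where
  "gt_page_output d n f W \<eta> b p x0 N =
     (if N = 0 then return_pmf x0
      else bind_pmf (pmf_of_set {..<N}) (\<lambda>k.
             map_pmf (\<lambda>s. node_mean (gt_x s)) (gt_page d n f W \<eta> b p x0 k)))"

end

theory Submission
  imports Defs
begin

text \<open>
  GT-PAGE is gradient descent on the average of the node variables, with three sources of error. The
  estimator \<open>y\<close> is not the gradient; the copies \<open>x\<close> of the nodes disagree; and the directions \<open>v\<close> of the nodes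
  disagree. Gradient tracking keeps the node mean of \<open>v\<close> equal to that of \<open>y\<close>, so the average point performs a
  descent step whose error is controlled by the estimator error and the disagreement in \<open>x\<close>
  (\<open>mean_descent\<close>, \<open>mean_direction_error\<close>).

  Each error contracts. By \<open>mixing_multi_stage\<close>, \<open>\<lceil>chi\<rceil>\<close> communications at least halve squared disagreements.
  The squared estimator error shrinks by the factor \<open>1 - p\<close> because of the full gradients. What is
  added back is proportional to the squared movement \<open>\<parallel>x' - x\<parallel>\<^sup>2\<close> of the iterates
  (\<open>page_tracking_error\<close>, \<open>page_increment\<close>), which is itself controlled by the disagreement in \<open>x\<close> and by
  the step size. Adding the three squared errors with suitable weights to the objective
  therefore gives a potential whose expectation drops by a multiple of the squared gradient norm in
  every iteration (\<open>potential_decrease\<close>), with step size \<open>1 / (80 * \<Lambda>)\<close>. Telescoping yields accuracy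
  \<open>\<epsilon>\<close> after a number of iterations of order \<open>\<Lambda> * \<Delta> / \<epsilon>\<^sup>2\<close>, up to a factor proportional to the number of
  nodes (\<open>expected_output_gradient\<close>).

  Two boundary cases shape the final count. The communication bound has no additive term, so if it is
  below one, no iteration is allowed; then \<open>initial_gradient\<close> shows that the starting point is
  accurate enough. And the batch size is rounded up to an integer, which is harmful if \<open>L\<close> far exceeds
  \<open>sqrt n * Lh\<close>; but by Jensen's inequality every node objective is also \<open>Lh\<close>-smooth, so one may work with
  \<open>\<Lambda> = min L (sqrt n * Lh)\<close>, for which \<open>b * \<Lambda>\<close> equals \<open>sqrt n * Lh\<close> up to a factor of two
  (\<open>batch_size_bounds\<close>). The lower half of this estimate bounds the minibatch variance, the upper half the
  oracle calls.
\<close>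

section \<open>Differential calculus on the coordinate subspaces\<close>

lemma subspace_Rn: "subspace (Rn d)"
  by (auto simp: subspace_def Rn_def)

lemmas Rn_closed = subspace_add[OF subspace_Rn] subspace_diff[OF subspace_Rn]
  subspace_scale[OF subspace_Rn] subspace_sum[OF subspace_Rn] subspace_0[OF subspace_Rn]

lemma coord_sum: "coord (\<Sum>a\<in>A. g a) i = (\<Sum>a\<in>A. coord (g a) i)"
  by (induction A rule: infinite_finite_induct) auto

lemma inner_Rn: "x \<in> Rn d \<Longrightarrow> inner x y = (\<Sum>i<d. coord x i * coord y i)"
  by (rule inner_rvec_superset) (auto simp: Rn_def intro: leI)

definition unit_rvec :: "nat \<Rightarrow> rvec" where
  "unit_rvec i = Abs_rvec (\<lambda>j. if j = i then 1 else 0)"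

lemma coord_unit_rvec: "coord (unit_rvec i) j = (if j = i then 1 else 0)"
  by (simp add: unit_rvec_def Abs_rvec_inverse)

lemma Rn_expansion:
  assumes "x \<in> Rn d"
  shows "x = (\<Sum>i<d. coord x i *\<^sub>R unit_rvec i)"
proof (rule rvec_eqI)
  fix j
  show "coord x j = coord (\<Sum>i<d. coord x i *\<^sub>R unit_rvec i) j"
    using assms by (auto simp: coord_sum coord_unit_rvec Rn_def if_distrib sum.delta' not_less cong: if_cong)
qed

lemma linear_Rn_representation:
  fixes D :: "rvec \<Rightarrow> real"
  assumes "linear D"
  obtains g where "g \<in> Rn d" "\<And>h. h \<in> Rn d \<Longrightarrow> D h = inner g h"
proof
  let ?g = "\<Sum>i<d. D (unit_rvec i) *\<^sub>R unit_rvec i"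
  show g: "?g \<in> Rn d"
    by (intro Rn_closed) (auto simp: Rn_def coord_unit_rvec)
  fix h assume "h \<in> Rn d"
  have "D h = D (\<Sum>i<d. coord h i *\<^sub>R unit_rvec i)"
    using Rn_expansion[OF \<open>h \<in> Rn d\<close>] by simp
  also have "\<dots> = (\<Sum>i<d. coord h i * D (unit_rvec i))"
    using assms by (simp add: linear_sum linear_cmul)
  also have "\<dots> = inner ?g h"
    unfolding inner_Rn[OF g]
    by (intro sum.cong refl) (simp add: coord_sum coord_unit_rvec if_distrib sum.delta' cong: if_cong)
  finally show "D h = inner ?g h" .
qed

lemma has_derivative_along_line:
  assumes "(f has_derivative inner g) (at (x + t *\<^sub>R h) within Rn d)" "x \<in> Rn d" "h \<in> Rn d"
  shows "((\<lambda>t. f (x + t *\<^sub>R h)) has_real_derivative inner g h) (at t)"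
proof -
  have line: "((\<lambda>t. x + t *\<^sub>R h) has_derivative (\<lambda>s. s *\<^sub>R h)) (at t)"
    by (auto intro!: derivative_eq_intros)
  have "range (\<lambda>t. x + t *\<^sub>R h) \<subseteq> Rn d"
    using assms by (auto intro!: Rn_closed)
  from has_derivative_in_compose[OF line has_derivative_subset[OF assms(1) this]]
  show ?thesis by (simp add: has_field_derivative_def mult_commute_abs)
qed

text \<open>
  Along the line through \<open>x\<close> in direction \<open>g' - g\<close>, which stays in \<open>Rn d\<close>, two candidate gradients give
  the same real derivative; hence \<open>g' - g\<close> is orthogonal to itself. The requirement \<open>g \<in> Rn d\<close> is what
  makes the gradient of a function seen only on \<open>Rn d\<close> unique.
\<close>

lemma grad_eqI:
  assumes "x \<in> Rn d" "g \<in> Rn d" "(f has_derivative inner g) (at x within Rn d)"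
  shows "grad d f x = g"
  unfolding grad_def
proof (rule the_equality)
  fix g' assume g': "g' \<in> Rn d \<and> (f has_derivative (\<lambda>h. inner g' h)) (at x within Rn d)"
  let ?h = "g' - g"
  have "?h \<in> Rn d" using g' assms by (auto intro: Rn_closed)
  with g' assms have "inner g ?h = inner g' ?h"
    using has_derivative_along_line[of f g x 0 ?h d] has_derivative_along_line[of f g' x 0 ?h d]
    by (auto dest: DERIV_unique)
  then have "inner ?h ?h = 0" by (simp add: inner_diff_left)
  then show "g' = g" by simp
qed (use assms in auto)

lemma has_derivative_grad:
  assumes "f differentiable_on Rn d" "x \<in> Rn d"
  shows "grad d f x \<in> Rn d" "(f has_derivative inner (grad d f x)) (at x within Rn d)"
proof -
  obtain D where D: "(f has_derivative D) (at x within Rn d)"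
    using assms by (auto simp: differentiable_on_def differentiable_def)
  obtain g where g: "g \<in> Rn d" "\<And>h. h \<in> Rn d \<Longrightarrow> D h = inner g h"
    using linear_Rn_representation has_derivative_linear[OF D] by metis
  have "(f has_derivative inner g) (at x within Rn d)"
    unfolding has_derivative_within
  proof (intro conjI bounded_linear_inner_right)
    have "((\<lambda>y. (1 / norm (y - x)) *\<^sub>R (f y - (f x + D (y - x)))) \<longlongrightarrow> 0) (at x within Rn d)"
      using D by (simp add: has_derivative_within)
    then show "((\<lambda>y. (1 / norm (y - x)) *\<^sub>R (f y - (f x + inner g (y - x)))) \<longlongrightarrow> 0) (at x within Rn d)"
      by (rule Lim_transform_eventually)
        (use assms(2) g(2) in \<open>auto simp: eventually_at_filter Rn_closed field_simps\<close>)
  qed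
  with g(1) assms(2) grad_eqI show "grad d f x \<in> Rn d" "(f has_derivative inner (grad d f x)) (at x within Rn d)"
    by metis+
qed

lemma grad_linear_combination:
  assumes "\<And>j. j \<in> J \<Longrightarrow> f j differentiable_on Rn d" "x \<in> Rn d"
  shows "grad d (\<lambda>x. c * (\<Sum>j\<in>J. f j x)) x = c *\<^sub>R (\<Sum>j\<in>J. grad d (f j) x)"
proof (rule grad_eqI)
  have "((\<lambda>x. c * (\<Sum>j\<in>J. f j x)) has_derivative (\<lambda>h. c * (\<Sum>j\<in>J. inner (grad d (f j) x) h))) (at x within Rn d)"
    by (intro has_derivative_mult_right has_derivative_sum has_derivative_grad assms)
  moreover have "(\<lambda>h. c * (\<Sum>j\<in>J. inner (grad d (f j) x) h)) = inner (c *\<^sub>R (\<Sum>j\<in>J. grad d (f j) x))"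
    by (simp add: fun_eq_iff inner_sum_left)
  ultimately show "((\<lambda>x. c * (\<Sum>j\<in>J. f j x)) has_derivative inner (c *\<^sub>R (\<Sum>j\<in>J. grad d (f j) x))) (at x within Rn d)"
    by simp
qed (use assms in \<open>auto intro!: Rn_closed has_derivative_grad\<close>)

text \<open>
  The quadratic upper model minus \<open>f\<close> has nonnegative derivative along the segment from \<open>x\<close> to \<open>x + h\<close>,
  because the gradient changes by at most \<open>L * t * norm h\<close> up to time \<open>t\<close>.
\<close>

lemma L_smooth_descent:
  assumes "f differentiable_on Rn d" "L_smooth d L f" and x: "x \<in> Rn d" and h: "h \<in> Rn d"
  shows "f (x + h) \<le> f x + inner (grad d f x) h + L / 2 * (norm h)\<^sup>2"
proof -
  let ?g = "grad d f"
  define \<phi> where "\<phi> t = f (x + t *\<^sub>R h) - t * inner (?g x) h - L / 2 * t\<^sup>2 * (norm h)\<^sup>2" for t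
  have "\<phi> 1 \<le> \<phi> 0"
  proof (rule DERIV_nonpos_imp_nonincreasing[of 0 1 \<phi>])
    fix t :: real assume t: "0 \<le> t" "t \<le> 1"
    let ?z = "x + t *\<^sub>R h"
    have z: "?z \<in> Rn d" using x h by (intro Rn_closed)
    have "(\<phi> has_real_derivative inner (?g ?z) h - inner (?g x) h - L * t * (norm h)\<^sup>2) (at t)"
      unfolding \<phi>_def
      by (rule derivative_eq_intros has_derivative_along_line[OF has_derivative_grad(2)[OF assms(1) z] x h] refl)+ simp
    moreover have "inner (?g ?z) h - inner (?g x) h \<le> L * t * (norm h)\<^sup>2"
    proof -
      have "inner (?g ?z) h - inner (?g x) h \<le> norm (?g ?z - ?g x) * norm h"
        by (metis inner_diff_left norm_cauchy_schwarz)
      also have "\<dots> \<le> (L * norm (?z - x)) * norm h"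
        using assms(2) z x unfolding L_smooth_def by (blast intro: mult_right_mono norm_ge_zero)
      also have "\<dots> = L * t * (norm h)\<^sup>2"
        using t by (simp add: power2_eq_square)
      finally show ?thesis .
    qed
    ultimately show "\<exists>y. (\<phi> has_real_derivative y) (at t) \<and> y \<le> 0" by force
  qed simp
  then show ?thesis by (simp add: \<phi>_def)
qed

text \<open>
  One gradient step of length \<open>1 / L\<close> lowers \<open>f\<close> by at least \<open>\<parallel>grad f\<parallel>\<^sup>2 / (2 * L)\<close>, and it cannot
  fall below \<open>l\<close>. This settles the case in which the starting point is already accurate enough and
  the iteration budget is below one.
\<close>

lemma L_smooth_gradient_gap:
  assumes "f differentiable_on Rn d" "L_smooth d L f" "L > 0" and x: "x \<in> Rn d"
    and lower: "\<And>z. z \<in> Rn d \<Longrightarrow> l \<le> f z"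
  shows "(norm (grad d f x))\<^sup>2 \<le> 2 * L * (f x - l)"
proof -
  let ?g = "grad d f x" and ?h = "(- 1 / L) *\<^sub>R grad d f x"
  have h: "?h \<in> Rn d" using has_derivative_grad(1)[OF assms(1) x] by (rule Rn_closed)
  have "l \<le> f (x + ?h)" using lower x h by (blast intro: Rn_closed)
  also have "\<dots> \<le> f x + inner ?g ?h + L / 2 * (norm ?h)\<^sup>2"
    by (rule L_smooth_descent[OF assms(1,2) x h])
  also have "\<dots> = f x - (norm ?g)\<^sup>2 / (2 * L)"
    using assms(3) by (simp add: dot_square_norm power_mult_distrib power_divide field_simps power2_eq_square)
  finally show ?thesis using assms(3) by (simp add: field_simps)
qed

section \<open>Expectations under finitely supported laws\<close>

lemma expectation_bind_finite:
  fixes h :: "'b \<Rightarrow> real"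
  assumes "finite (set_pmf M)" "\<And>s. s \<in> set_pmf M \<Longrightarrow> finite (set_pmf (K s))"
  shows "measure_pmf.expectation (bind_pmf M K) h =
    measure_pmf.expectation M (\<lambda>s. measure_pmf.expectation (K s) h)"
  using assms by (subst pmf_expectation_bind[of "set_pmf M"])
    (auto simp: integral_measure_pmf[of "set_pmf M" M])

lemma expectation_mono_finite:
  fixes g h :: "'b \<Rightarrow> real"
  assumes "finite (set_pmf M)" "\<And>s. s \<in> set_pmf M \<Longrightarrow> g s \<le> h s"
  shows "measure_pmf.expectation M g \<le> measure_pmf.expectation M h"
  using assms by (intro integral_mono_AE integrable_measure_pmf_finite) (auto simp: AE_measure_pmf_iff)

lemma expectation_affine_finite:
  fixes g h :: "'b \<Rightarrow> real"
  assumes "finite (set_pmf M)"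
  shows "measure_pmf.expectation M (\<lambda>s. a + \<beta> * g s + c * h s)
    = a + \<beta> * measure_pmf.expectation M g + c * measure_pmf.expectation M h"
  using assms by (simp add: integrable_measure_pmf_finite)

text \<open>
  The parallel axis theorem. It is used for the variance of a minibatch, for averaging smooth
  components, and for splitting a stacked vector into its consensus part and its deviation.
\<close>

lemma sum_square_deviation:
  fixes z :: "'a \<Rightarrow> 'b::real_inner"
  assumes "finite J" "J \<noteq> {}"
  defines "mu \<equiv> (1 / real (card J)) *\<^sub>R (\<Sum>j\<in>J. z j)"
  shows "(\<Sum>j\<in>J. (norm (z j - mu))\<^sup>2) = (\<Sum>j\<in>J. (norm (z j))\<^sup>2) - real (card J) * (norm mu)\<^sup>2"
proof -
  have card: "card J > 0" using assms by (simp add: card_gt_0_iff)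
  have "(\<Sum>j\<in>J. (norm (z j - mu))\<^sup>2)
      = (\<Sum>j\<in>J. (norm (z j))\<^sup>2) - 2 * inner (\<Sum>j\<in>J. z j) mu + real (card J) * (norm mu)\<^sup>2"
    by (simp add: power2_norm_eq_inner inner_diff_left inner_diff_right sum.distrib sum_subtractf
        inner_sum_right inner_commute sum_distrib_left algebra_simps)
  also have "(\<Sum>j\<in>J. z j) = real (card J) *\<^sub>R mu"
    using card by (simp add: mu_def)
  finally show ?thesis by (simp add: dot_square_norm)
qed

text \<open>
  Independent centred terms add no cross terms to the second moment. The proof exposes one sample at a
  time: given the later ones, the fixed vector \<open>w\<close> has merely been shifted by \<open>h j\<close>, and the average over
  \<open>j\<close> of \<open>\<parallel>w + h j\<parallel>\<^sup>2\<close> has no linear term. All averages are finite sums of reals, so the vector space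
  need not be complete. The set \<open>K\<close> of samples that are used may be smaller than the set \<open>I\<close> of all
  samples drawn.
\<close>

lemma expectation_square_independent_sum:
  fixes h :: "'a \<Rightarrow> 'b::real_inner" and I :: "'c set"
  assumes I: "finite I" "K \<subseteq> I" and J: "finite J" "J \<noteq> {}" and centred: "(\<Sum>j\<in>J. h j) = 0"
  shows "measure_pmf.expectation (Pi_pmf I dflt (\<lambda>_. pmf_of_set J)) (\<lambda>S. (norm (w + (\<Sum>k\<in>K. h (S k))))\<^sup>2)
    = (norm w)\<^sup>2 + real (card K) * ((\<Sum>j\<in>J. (norm (h j))\<^sup>2) / real (card J))"
proof -
  let ?q = "\<lambda>_ :: 'c. pmf_of_set J" and ?var = "(\<Sum>j\<in>J. (norm (h j))\<^sup>2) / real (card J)"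
  let ?E = "\<lambda>K w. measure_pmf.expectation (Pi_pmf K dflt ?q) (\<lambda>S. (norm (w + (\<Sum>k\<in>K. h (S k))))\<^sup>2)"
  have fin: "finite (set_pmf (Pi_pmf K dflt ?q))" if "finite K" for K
    using that J by (simp add: set_Pi_pmf finite_PiE_dflt)
  have card: "real (card J) > 0" using J by (simp add: card_gt_0_iff)
  have K: "finite K" using I finite_subset by auto
  have E: "?E K w = (norm w)\<^sup>2 + real (card K) * ?var"
    using K
  proof (induction K arbitrary: w)
    case empty
    then show ?case by simp
  next
    case (insert k K)
    have upd: "(\<Sum>l\<in>insert k K. h ((S(k := j)) l)) = h j + (\<Sum>l\<in>K. h (S l))" for S j
      using insert.hyps by (auto intro!: sum.cong)
    have "?E (insert k K) w = measure_pmf.expectation (pmf_of_set J) (\<lambda>j. ?E K (w + h j))"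
      unfolding Pi_pmf_insert'[OF insert.hyps]
      using J insert.hyps
      by (simp add: expectation_bind_finite fin upd add.assoc del: sum.insert fun_upd_apply)
    also have "\<dots> = (\<Sum>j\<in>J. (norm (w + h j))\<^sup>2) / real (card J) + real (card K) * ?var"
      unfolding insert.IH using J card by (simp add: integral_pmf_of_set sum.distrib add_divide_distrib)
    also have "(\<Sum>j\<in>J. (norm (w + h j))\<^sup>2) = real (card J) * (norm w)\<^sup>2 + 2 * inner w (\<Sum>j\<in>J. h j) + (\<Sum>j\<in>J. (norm (h j))\<^sup>2)"
      by (simp add: power2_norm_eq_inner inner_add_left inner_add_right sum.distrib
          inner_sum_right inner_commute sum_distrib_left)
    finally show ?case
      using insert.hyps card centred by (simp add: field_simps)
  qed
  have "?E K w = measure_pmf.expectation (Pi_pmf I dflt ?q) (\<lambda>S. (norm (w + (\<Sum>k\<in>K. h (S k))))\<^sup>2)"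
    unfolding Pi_pmf_subset[OF I, of dflt ?q] by (auto intro!: Bochner_Integration.integral_cong sum.cong arg_cong[of _ _ norm])
  with E show ?thesis by simp
qed

section \<open>Gossip averaging\<close>

definition dev :: "rvec ^ 'm \<Rightarrow> rvec ^ ('m::finite)" where
  "dev x = x - (\<chi> i. node_mean x)"

definition Rn_stack :: "nat \<Rightarrow> (rvec ^ ('m::finite)) set" where
  "Rn_stack d = {x. \<forall>i. x $ i \<in> Rn d}"

lemma norm_vec_square: "(norm x)\<^sup>2 = (\<Sum>i\<in>UNIV. (norm (x $ i))\<^sup>2)"
  for x :: "'a::real_inner ^ 'm::finite"
  by (simp add: power2_norm_eq_inner inner_vec_def)

lemma subspace_Rn_stack: "subspace (Rn_stack d)"
  by (auto simp: subspace_def Rn_stack_def Rn_closed)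

lemmas Rn_stack_closed = subspace_add[OF subspace_Rn_stack] subspace_diff[OF subspace_Rn_stack]
  subspace_scale[OF subspace_Rn_stack]

lemma Rn_stack_iff: "x \<in> Rn_stack d \<longleftrightarrow> (\<forall>i. x $ i \<in> Rn d)"
  by (simp add: Rn_stack_def)

lemma node_mean_add: "node_mean (x + y) = node_mean x + node_mean y"
  and node_mean_diff: "node_mean (x - y) = node_mean x - node_mean y"
  and node_mean_scaleR: "node_mean (c *\<^sub>R x) = c *\<^sub>R node_mean x"
  and node_mean_const: "node_mean (\<chi> i. a) = a"
  by (simp_all add: node_mean_def sum.distrib sum_subtractf scaleR_sum_right algebra_simps sum_constant_scaleR del: sum_constant)

lemma node_mean_Rn: "x \<in> Rn_stack d \<Longrightarrow> node_mean x \<in> Rn d"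
  by (auto simp: node_mean_def Rn_stack_def intro!: Rn_closed)

lemma sum_eq_node_mean: "(\<Sum>i\<in>UNIV. x $ i) = real CARD('m) *\<^sub>R node_mean x"
  for x :: "rvec ^ 'm::finite"
  by (simp add: node_mean_def)

lemma dev_add: "dev (x + y) = dev x + dev y"
  and dev_scaleR: "dev (c *\<^sub>R x) = c *\<^sub>R dev x"
  and dev_uminus: "dev (- x) = - dev x"
  using node_mean_scaleR[of "- 1" x]
  by (simp_all add: dev_def node_mean_add node_mean_diff node_mean_scaleR vec_eq_iff algebra_simps)

lemma dev_Rn_stack: "x \<in> Rn_stack d \<Longrightarrow> dev x \<in> Rn_stack d"
  by (auto simp: dev_def Rn_stack_def intro!: Rn_closed node_mean_Rn)

lemma node_mean_dev: "node_mean (dev x) = 0"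
  by (simp add: dev_def node_mean_diff node_mean_const)

lemma dev_const: "dev (\<chi> i. a) = 0"
  by (simp add: dev_def node_mean_const)

lemma norm_square_dev_mean:
  "(norm x)\<^sup>2 = (norm (dev x))\<^sup>2 + real CARD('m) * (norm (node_mean x))\<^sup>2" for x :: "rvec ^ 'm::finite"
  using sum_square_deviation[of "UNIV :: 'm set" "\<lambda>i. x $ i"]
  by (simp add: norm_vec_square dev_def node_mean_def[symmetric])

lemma norm_dev_le: "(norm (dev x))\<^sup>2 \<le> (norm x)\<^sup>2"
  by (simp add: norm_square_dev_mean[of x])

text \<open>
  What the optimization argument needs from a round of communication, in a form that products of
  matrices inherit. In terms of the gossip matrix it concerns \<open>I - W\<close>, so that several communications in
  a row correspond to a product.
\<close>

definition mixing :: "nat \<Rightarrow> real \<Rightarrow> real ^ 'm ^ ('m::finite) \<Rightarrow> bool" where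
  "mixing d \<rho> P \<longleftrightarrow>
     (\<forall>x. node_mean (kron_apply P x) = node_mean x) \<and>
     (\<forall>a. kron_apply P (\<chi> i. a) = (\<chi> i. a)) \<and>
     (\<forall>x\<in>Rn_stack d. node_mean x = 0 \<longrightarrow> (norm (kron_apply P x))\<^sup>2 \<le> \<rho> * (norm x)\<^sup>2)"

lemma kron_apply_add: "kron_apply A (x + y) = kron_apply A x + kron_apply A y"
  by (simp add: kron_apply_def vec_eq_iff sum.distrib scaleR_right_distrib)

lemma kron_apply_matrix_diff: "kron_apply (A - B) x = kron_apply A x - kron_apply B x"
  by (simp add: kron_apply_def vec_eq_iff sum_subtractf scaleR_left_diff_distrib)

lemma kron_apply_mat_1: "kron_apply (mat 1) x = x"
  by (simp add: kron_apply_def mat_def vec_eq_iff if_distrib[of "\<lambda>c. c *\<^sub>R _"] sum.delta cong: if_cong)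

lemma kron_apply_mult: "kron_apply (A ** B) x = kron_apply A (kron_apply B x)"
proof -
  have "(\<Sum>j\<in>UNIV. (\<Sum>k\<in>UNIV. A $ i $ k * B $ k $ j) *\<^sub>R x $ j)
      = (\<Sum>k\<in>UNIV. A $ i $ k *\<^sub>R (\<Sum>j\<in>UNIV. B $ k $ j *\<^sub>R x $ j))" for i
    by (simp add: scaleR_sum_left scaleR_sum_right) (rule sum.swap)
  then show ?thesis by (simp add: kron_apply_def matrix_matrix_mult_def vec_eq_iff)
qed

lemma kron_apply_Rn_stack: "x \<in> Rn_stack d \<Longrightarrow> kron_apply A x \<in> Rn_stack d"
  by (auto simp: kron_apply_def Rn_stack_def intro!: Rn_closed)

lemma mixing_mono:
  assumes "mixing d \<rho> P" "\<rho> \<le> \<sigma>"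
  shows "mixing d \<sigma> P"
  unfolding mixing_def
proof (intro conjI allI ballI impI)
  fix x :: "rvec ^ 'a" assume "x \<in> Rn_stack d" "node_mean x = 0"
  then have "(norm (kron_apply P x))\<^sup>2 \<le> \<rho> * (norm x)\<^sup>2"
    using assms(1) by (simp add: mixing_def)
  also have "\<dots> \<le> \<sigma> * (norm x)\<^sup>2"
    by (intro mult_right_mono assms(2)) simp
  finally show "(norm (kron_apply P x))\<^sup>2 \<le> \<sigma> * (norm x)\<^sup>2" .
qed (use assms in \<open>auto simp: mixing_def\<close>)

lemma mixing_identity: "mixing d 1 (mat 1)"
  by (simp add: mixing_def kron_apply_mat_1)

lemma mixing_mult:
  assumes P: "mixing d \<rho> P" and Q: "mixing d \<sigma> Q" and "0 \<le> \<sigma>"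
  shows "mixing d (\<sigma> * \<rho>) (Q ** P)"
  unfolding mixing_def kron_apply_mult
proof (intro conjI allI ballI impI)
  fix x :: "rvec ^ 'a" assume x: "x \<in> Rn_stack d" "node_mean x = 0"
  have "(norm (kron_apply Q (kron_apply P x)))\<^sup>2 \<le> \<sigma> * (norm (kron_apply P x))\<^sup>2"
    using P Q x by (simp add: mixing_def kron_apply_Rn_stack)
  also have "\<dots> \<le> \<sigma> * (\<rho> * (norm x)\<^sup>2)"
    using P x \<open>0 \<le> \<sigma>\<close> by (intro mult_left_mono) (auto simp: mixing_def)
  finally show "(norm (kron_apply Q (kron_apply P x)))\<^sup>2 \<le> \<sigma> * \<rho> * (norm x)\<^sup>2"
    by (simp add: mult.assoc)
qed (use P Q in \<open>auto simp: mixing_def\<close>)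

text \<open>
  The range condition says that the columns of \<open>W k\<close> sum to zero, which preserves means; the kernel
  condition says the same for the rows, which fixes consensus vectors.
\<close>

lemma gossip_mixing:
  assumes "gossip d chi E W"
  shows "mixing d (1 - inverse chi) (mat 1 - W k)"
proof -
  let ?W = "W k"
  have ker: "?W *v (\<chi> i. 1) = 0"
  proof -
    have "(\<chi> i. 1) \<in> {a :: real ^ 'a. \<forall>i j. a $ i = a $ j}" by simp
    then show ?thesis using assms unfolding gossip_def by blast
  qed
  have row: "(\<Sum>j\<in>UNIV. ?W $ i $ j) = 0" for i
    using arg_cong[OF ker, of "\<lambda>v. v $ i"] by (simp add: matrix_vector_mult_def)
  have "(\<Sum>i\<in>UNIV. (?W *v axis j 1) $ i) = 0" for j
    using assms unfolding gossip_def by blast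
  then have col: "(\<Sum>i\<in>UNIV. ?W $ i $ j) = 0" for j
    by (simp add: matrix_vector_mult_basis column_def)
  have "(\<Sum>i\<in>UNIV. kron_apply ?W x $ i) = 0" for x
  proof -
    have "(\<Sum>i\<in>UNIV. kron_apply ?W x $ i) = (\<Sum>j\<in>UNIV. \<Sum>i\<in>UNIV. ?W $ i $ j *\<^sub>R x $ j)"
      by (simp add: kron_apply_def) (rule sum.swap)
    also have "\<dots> = (\<Sum>j\<in>UNIV. (\<Sum>i\<in>UNIV. ?W $ i $ j) *\<^sub>R x $ j)"
      by (simp add: scaleR_sum_left)
    finally show ?thesis by (simp add: col)
  qed
  then have mean: "node_mean (kron_apply ?W x) = 0" for x
    by (simp add: node_mean_def)
  have const: "kron_apply ?W (\<chi> i. a) = 0" for a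
    by (simp add: kron_apply_def vec_eq_iff row flip: scaleR_sum_left)
  have contract: "(norm (kron_apply ?W x - x))\<^sup>2 \<le> (1 - inverse chi) * (norm x)\<^sup>2"
    if "x \<in> Rn_stack d" "node_mean x = 0" for x
    using assms that unfolding gossip_def by (simp add: Rn_stack_def sum_eq_node_mean)
  show ?thesis
    using mean const contract
    by (simp add: mixing_def kron_apply_matrix_diff kron_apply_mat_1 node_mean_diff norm_minus_commute)
qed

lemma mixing_consensus_prod:
  assumes "gossip d chi E W" "chi \<ge> 1"
  shows "mixing d ((1 - inverse chi) ^ t) (consensus_prod W s t)"
proof (induction t)
  case (Suc t)
  have "0 \<le> 1 - inverse chi" using assms by (simp add: inverse_le_1_iff)
  with Suc gossip_mixing[OF assms(1)] show ?case
    by (simp add: mixing_mult)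
qed (simp add: mixing_identity)

text \<open>
  \<open>(1 - 1 / chi) ^ T \<le> exp (- T / chi) \<le> 1 / e\<close> once \<open>T \<ge> chi\<close>. This is why \<open>\<lceil>chi\<rceil>\<close> communications per
  iteration make the contraction factor, and with it the step size, independent of the network.
\<close>

lemma multi_stage_contraction:
  assumes "chi \<ge> 1"
  shows "(1 - inverse chi) ^ nat \<lceil>chi\<rceil> \<le> (1 / 2 :: real)"
proof -
  let ?T = "nat \<lceil>chi\<rceil>"
  have T: "chi \<le> real ?T" by linarith
  have "(1 - inverse chi) ^ ?T \<le> exp (- inverse chi) ^ ?T"
    using assms exp_ge_add_one_self[of "- inverse chi"]
    by (intro power_mono) (auto simp: inverse_le_1_iff)
  also have "\<dots> = exp (- (real ?T / chi))"
    by (simp add: exp_of_nat_mult[symmetric] divide_inverse)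
  also have "\<dots> \<le> exp (- 1)"
    using T assms by (simp add: field_simps)
  also have "\<dots> \<le> 1 / 2"
    using exp_ge_add_one_self[of 1] by (simp add: exp_minus field_simps)
  finally show ?thesis .
qed

lemma mixing_multi_stage:
  assumes "gossip d chi E W" "chi \<ge> 1"
  shows "mixing d (1 / 2) (mat 1 - multi_stage W (nat \<lceil>chi\<rceil>) k)"
proof -
  let ?T = "nat \<lceil>chi\<rceil>"
  have "mixing d (1 / 2) (consensus_prod W (k * ?T) ?T)"
    by (rule mixing_mono[OF mixing_consensus_prod[OF assms] multi_stage_contraction[OF assms(2)]])
  then show ?thesis by (simp add: multi_stage_def)
qed

lemma kron_apply_dev:
  assumes "mixing d \<rho> P"
  shows "dev (kron_apply P x) = kron_apply P (dev x)"
proof -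
  have "kron_apply P x = kron_apply P (dev x + (\<chi> i. node_mean x))"
    by (simp add: dev_def)
  also have "\<dots> = kron_apply P (dev x) + (\<chi> i. node_mean x)"
    using assms by (simp add: kron_apply_add mixing_def)
  finally show ?thesis
    using assms by (simp add: dev_def mixing_def vec_eq_iff)
qed

text \<open>
  Young's inequality.
\<close>

lemma norm_add_square_le:
  fixes u v :: "'a::real_inner"
  assumes "c > 0"
  shows "(norm (u + v))\<^sup>2 \<le> (1 + c) * (norm u)\<^sup>2 + (1 + 1 / c) * (norm v)\<^sup>2"
proof -
  have "(norm (c *\<^sub>R u - v))\<^sup>2 = c * (c * (norm u)\<^sup>2) - c * (2 * inner u v) + (norm v)\<^sup>2"
    by (simp add: power2_norm_eq_inner inner_diff_left inner_diff_right inner_commute algebra_simps)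
  then have "c * (2 * inner u v) \<le> c * (c * (norm u)\<^sup>2) + (norm v)\<^sup>2"
    using zero_le_power2[of "norm (c *\<^sub>R u - v)"] by linarith
  with assms have "2 * inner u v \<le> c * (norm u)\<^sup>2 + 1 / c * (norm v)\<^sup>2"
    by (simp add: field_simps)
  then show ?thesis
    by (simp add: power2_norm_eq_inner inner_add_left inner_add_right inner_commute algebra_simps)
qed

lemma norm_add_square_le2: "(norm (u + v))\<^sup>2 \<le> 2 * (norm u)\<^sup>2 + 2 * (norm v)\<^sup>2"
  for u v :: "'a::real_inner"
  using norm_add_square_le[of 1 u v] by simp

lemma norm_diff_square_le2: "(norm (u - v))\<^sup>2 \<le> 2 * (norm u)\<^sup>2 + 2 * (norm v)\<^sup>2"
  for u v :: "'a::real_inner"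
  using norm_add_square_le2[of u "- v"] by simp

text \<open>
  Young's inequality with \<open>c = 1 / 2\<close> trades the contraction factor \<open>1 / 2\<close> for \<open>3 / 4\<close>, which still
  leaves room for the perturbation \<open>w\<close>.
\<close>

lemma mixing_perturbed:
  assumes P: "mixing d (1 / 2) P" and "x \<in> Rn_stack d"
  shows "(norm (dev (kron_apply P x + w)))\<^sup>2 \<le> 3 / 4 * (norm (dev x))\<^sup>2 + 3 * (norm (dev w))\<^sup>2"
proof -
  have "(norm (dev (kron_apply P x + w)))\<^sup>2
      \<le> 3 / 2 * (norm (kron_apply P (dev x)))\<^sup>2 + 3 * (norm (dev w))\<^sup>2"
    using norm_add_square_le[of "1 / 2" "kron_apply P (dev x)" "dev w"]
    by (simp add: dev_add kron_apply_dev[OF P])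
  also have "(norm (kron_apply P (dev x)))\<^sup>2 \<le> 1 / 2 * (norm (dev x))\<^sup>2"
    using P assms(2) by (simp add: mixing_def dev_Rn_stack node_mean_dev)
  finally show ?thesis by linarith
qed

text \<open>
  Mixing moves only the part of \<open>x\<close> off consensus, since consensus vectors are fixed. Hence the nodes move
  far only if they disagree or the descent direction is large.
\<close>

lemma mixing_displacement:
  assumes P: "mixing d (1 / 2) P" and "x \<in> Rn_stack d"
  shows "(norm (kron_apply P x - w - x))\<^sup>2 \<le> 8 * (norm (dev x))\<^sup>2 + 2 * (norm w)\<^sup>2"
proof -
  have fixed: "kron_apply P x - x = kron_apply P (dev x) - dev x"
    using assms by (simp flip: kron_apply_dev[OF P]) (simp add: dev_def mixing_def vec_eq_iff)
  have "(norm (kron_apply P x - x))\<^sup>2 \<le> 4 * (norm (dev x))\<^sup>2"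
  proof -
    have "(norm (kron_apply P (dev x)))\<^sup>2 \<le> 1 / 2 * (norm (dev x))\<^sup>2"
      using P assms(2) by (simp add: mixing_def dev_Rn_stack node_mean_dev)
    with norm_diff_square_le2[of "kron_apply P (dev x)" "dev x"] zero_le_power2[of "norm (dev x)"]
    show ?thesis unfolding fixed by linarith
  qed
  moreover have "(norm (kron_apply P x - w - x))\<^sup>2 \<le> 2 * (norm (kron_apply P x - x))\<^sup>2 + 2 * (norm w)\<^sup>2"
    using norm_diff_square_le2[of "kron_apply P x - x" w] by (simp add: algebra_simps)
  ultimately show ?thesis by simp
qed

section \<open>The recursive gradient estimator\<close>

lemma grad_node_obj:
  assumes "\<And>j. j \<in> {1..n} \<Longrightarrow> f i j differentiable_on Rn d" "u \<in> Rn d"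
  shows "grad d (node_obj n f i) u = (1 / real n) *\<^sub>R (\<Sum>j=1..n. grad d (f i j) u)"
  unfolding node_obj_def[abs_def] by (intro grad_linear_combination assms)

text \<open>
  Jensen's inequality. An \<open>L\<close>-smooth problem with \<open>L > Lh\<close> is therefore really \<open>Lh\<close>-smooth.
\<close>

lemma avg_smooth_imp_L_smooth:
  assumes "n \<ge> 1" "\<And>j. j \<in> {1..n} \<Longrightarrow> f i j differentiable_on Rn d"
    and "avg_smooth d n Lh (f i)" "Lh \<ge> 0"
  shows "L_smooth d Lh (node_obj n f i)"
  unfolding L_smooth_def
proof (intro ballI)
  fix u v assume uv: "u \<in> Rn d" "v \<in> Rn d"
  define \<delta> where "\<delta> j = grad d (f i j) u - grad d (f i j) v" for j
  let ?\<mu> = "grad d (node_obj n f i) u - grad d (node_obj n f i) v"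
  have grad: "grad d (node_obj n f i) z = (1 / real n) *\<^sub>R (\<Sum>j=1..n. grad d (f i j) z)" if "z \<in> Rn d" for z
    using assms(2) that by (intro grad_node_obj)
  have \<mu>: "?\<mu> = (1 / real (card {1..n})) *\<^sub>R (\<Sum>j\<in>{1..n}. \<delta> j)"
    using uv by (simp add: grad \<delta>_def sum_subtractf scaleR_diff_right)
  have "0 \<le> (\<Sum>j\<in>{1..n}. (norm (\<delta> j - ?\<mu>))\<^sup>2)" by (intro sum_nonneg) simp
  also have "\<dots> = (\<Sum>j\<in>{1..n}. (norm (\<delta> j))\<^sup>2) - real n * (norm ?\<mu>)\<^sup>2"
    using sum_square_deviation[of "{1..n}" \<delta>] assms(1) unfolding \<mu> by simp
  finally have "(norm ?\<mu>)\<^sup>2 \<le> 1 / real n * (\<Sum>j=1..n. (norm (\<delta> j))\<^sup>2)"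
    using assms(1) by (simp add: field_simps)
  also have "\<dots> \<le> (Lh * norm (u - v))\<^sup>2"
    using assms(3) uv by (simp add: avg_smooth_def \<delta>_def power_mult_distrib)
  finally show "norm ?\<mu> \<le> Lh * norm (u - v)"
    by (rule power2_le_imp_le) (simp add: assms(4))
qed

lemma L_smooth_mono: "L_smooth d L F \<Longrightarrow> L \<le> M \<Longrightarrow> L_smooth d M F"
  unfolding L_smooth_def by (meson mult_right_mono norm_ge_zero order_trans)

text \<open>
  \<open>\<Lambda>\<close> is the smoothness constant on which the step size is based. The assumption \<open>batch_size\<close> is the
  only link between \<open>b\<close>, \<open>p\<close>, \<open>Lh\<close> and \<open>\<Lambda>\<close>: the sampling variance added by one minibatch step is at
  most the fraction \<open>p\<close> of the squared movement \<open>\<Lambda>\<^sup>2\<parallel>x' - x\<parallel>\<^sup>2\<close>, so that full gradients,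
  taken with probability \<open>p\<close>, remove the error as fast as it accumulates.
\<close>

locale gt_page_problem =
  fixes d n :: nat and f :: "'m::finite \<Rightarrow> nat \<Rightarrow> rvec \<Rightarrow> real" and \<Lambda> Lh :: real and b :: nat and p :: real
  assumes n: "n \<ge> 1" and b: "b \<ge> 1" and \<Lambda>: "\<Lambda> > 0" and p: "0 < p" "p \<le> 1"
    and component_differentiable: "\<And>i j. j \<in> {1..n} \<Longrightarrow> f i j differentiable_on Rn d"
    and node_smooth: "\<And>i. L_smooth d \<Lambda> (node_obj n f i)"
    and average_smooth: "\<And>i. avg_smooth d n Lh (f i)"
    and batch_size: "(1 - p) * Lh\<^sup>2 / real b \<le> p * \<Lambda>\<^sup>2"
begin

abbreviation G :: "rvec ^ 'm \<Rightarrow> rvec ^ 'm" where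
  "G \<equiv> full_grad d n f"

abbreviation F :: "rvec \<Rightarrow> real" where
  "F \<equiv> obj n f"

abbreviation sampling :: "('m \<times> nat \<Rightarrow> nat) pmf" where
  "sampling \<equiv> Pi_pmf (UNIV \<times> {..<b}) 0 (\<lambda>_. pmf_of_set {1..n})"

definition minibatch_estimate ::
  "rvec ^ 'm \<Rightarrow> rvec ^ 'm \<Rightarrow> rvec ^ 'm \<Rightarrow> ('m \<times> nat \<Rightarrow> nat) \<Rightarrow> rvec ^ 'm" where
  "minibatch_estimate x y x' S = (\<chi> i. y $ i + (1 / real b) *\<^sub>R
     (\<Sum>l<b. grad d (f i (S (i, l))) (x' $ i) - grad d (f i (S (i, l))) (x $ i)))"

lemma finite_sampling: "finite (set_pmf sampling)"
  using n by (simp add: set_Pi_pmf finite_PiE_dflt)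

lemma sampled_index: "S \<in> set_pmf sampling \<Longrightarrow> l < b \<Longrightarrow> S (i, l) \<in> {1..n}"
  using n by (auto simp: set_Pi_pmf PiE_dflt_def)

lemma node_differentiable: "node_obj n f i differentiable_on Rn d"
  unfolding node_obj_def[abs_def] differentiable_on_def
proof
  fix x assume "x \<in> Rn d"
  then show "(\<lambda>x. 1 / real n * (\<Sum>j = 1..n. f i j x)) differentiable at x within Rn d"
    using component_differentiable
    by (intro differentiable_mult differentiable_sum) (auto simp: differentiable_on_def)
qed

lemma grad_component_mean:
  "u \<in> Rn d \<Longrightarrow> grad d (node_obj n f i) u = (1 / real n) *\<^sub>R (\<Sum>j=1..n. grad d (f i j) u)"
  by (rule grad_node_obj[OF component_differentiable])

lemma obj_eq: "F = (\<lambda>x. 1 * (\<Sum>i\<in>UNIV. node_obj n f i x))"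
  by (simp add: obj_def fun_eq_iff)

lemma obj_differentiable: "F differentiable_on Rn d"
  unfolding obj_eq differentiable_on_def
  by (intro ballI differentiable_mult differentiable_sum)
    (use node_differentiable in \<open>auto simp: differentiable_on_def\<close>)

lemma grad_obj: "u \<in> Rn d \<Longrightarrow> grad d F u = (\<Sum>i\<in>UNIV. grad d (node_obj n f i) u)"
  unfolding obj_eq by (subst grad_linear_combination) (auto intro: node_differentiable)

lemma obj_smooth: "L_smooth d (real CARD('m) * \<Lambda>) F"
  unfolding L_smooth_def
proof (intro ballI)
  fix u v assume uv: "u \<in> Rn d" "v \<in> Rn d"
  have "norm (grad d F u - grad d F v)
      \<le> (\<Sum>i\<in>UNIV. norm (grad d (node_obj n f i) u - grad d (node_obj n f i) v))"
    using uv by (simp add: grad_obj norm_sum flip: sum_subtractf)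
  also have "\<dots> \<le> (\<Sum>i\<in>(UNIV :: 'm set). \<Lambda> * norm (u - v))"
    using uv node_smooth by (intro sum_mono) (auto simp: L_smooth_def)
  finally show "norm (grad d F u - grad d F v) \<le> real CARD('m) * \<Lambda> * norm (u - v)"
    by simp
qed

lemma G_Rn_stack: "x \<in> Rn_stack d \<Longrightarrow> G x \<in> Rn_stack d"
  by (simp add: Rn_stack_def full_grad_def has_derivative_grad(1)[OF node_differentiable])

lemma G_lipschitz:
  assumes "x \<in> Rn_stack d" "x' \<in> Rn_stack d"
  shows "(norm (G x' - G x))\<^sup>2 \<le> \<Lambda>\<^sup>2 * (norm (x' - x))\<^sup>2"
proof -
  have "(norm (G x' - G x))\<^sup>2 \<le> (\<Sum>i\<in>UNIV. (\<Lambda> * norm ((x' - x) $ i))\<^sup>2)"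
    unfolding norm_vec_square using assms node_smooth
    by (intro sum_mono power_mono) (auto simp: full_grad_def L_smooth_def Rn_stack_def)
  then show ?thesis by (simp add: norm_vec_square[of "x' - x"] power_mult_distrib sum_distrib_left)
qed

lemma minibatch_Rn_stack:
  assumes "x \<in> Rn_stack d" "y \<in> Rn_stack d" "x' \<in> Rn_stack d" "S \<in> set_pmf sampling"
  shows "minibatch_estimate x y x' S \<in> Rn_stack d"
  using assms sampled_index[OF assms(4)]
  by (auto simp: Rn_stack_def minibatch_estimate_def
      intro!: Rn_closed has_derivative_grad(1) component_differentiable)

text \<open>
  The reference point \<open>z\<close> is kept general: \<open>z = G x'\<close> gives the tracking error of the estimator and
  \<open>z = y\<close> gives the size of its increment. In both cases the mean of the estimator is
  \<open>y + (G x' - G x)\<close>, and its variance is \<open>1 / b\<close> times that of a single sampled gradient difference, which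
  average smoothness bounds.
\<close>

lemma minibatch_error:
  assumes x: "x \<in> Rn_stack d" and x': "x' \<in> Rn_stack d"
  shows "measure_pmf.expectation sampling (\<lambda>S. (norm (minibatch_estimate x y x' S - z))\<^sup>2)
    \<le> (norm (y + (G x' - G x) - z))\<^sup>2 + Lh\<^sup>2 / real b * (norm (x' - x))\<^sup>2"
proof -
  have node: "measure_pmf.expectation sampling (\<lambda>S. (norm ((minibatch_estimate x y x' S - z) $ i))\<^sup>2)
      \<le> (norm ((y + (G x' - G x) - z) $ i))\<^sup>2 + Lh\<^sup>2 / real b * (norm ((x' - x) $ i))\<^sup>2" for i
  proof -
    have xi: "x $ i \<in> Rn d" "x' $ i \<in> Rn d" using x x' by (auto simp: Rn_stack_def)
    define \<delta> where "\<delta> j = grad d (f i j) (x' $ i) - grad d (f i j) (x $ i)" for j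
    define \<mu> where "\<mu> = (1 / real (card {1..n})) *\<^sub>R (\<Sum>j\<in>{1..n}. \<delta> j)"
    define h where "h j = (1 / real b) *\<^sub>R (\<delta> j - \<mu>)" for j
    let ?w = "(y + (G x' - G x) - z) $ i" and ?K = "{i} \<times> {..<b}"
    have \<mu>: "(G x' - G x) $ i = \<mu>"
      using xi by (simp add: full_grad_def grad_component_mean \<mu>_def \<delta>_def sum_subtractf scaleR_diff_right)
    have estimate: "(minibatch_estimate x y x' S - z) $ i = ?w + (\<Sum>k\<in>?K. h (S k))" for S
    proof -
      have "(\<Sum>k\<in>?K. h (S k)) = (\<Sum>l<b. h (S (i, l)))"
        by (rule sum.reindex_bij_witness[of _ "\<lambda>l. (i, l)" snd]) auto
      also have "\<dots> = (1 / real b) *\<^sub>R (\<Sum>l<b. \<delta> (S (i, l))) - \<mu>"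
        using b by (simp add: h_def sum_subtractf scaleR_diff_right sum_constant_scaleR flip: scaleR_sum_right)
      finally show ?thesis
        using \<mu> by (simp add: minibatch_estimate_def \<delta>_def algebra_simps)
    qed
    have "(\<Sum>j\<in>{1..n}. h j) = 0"
      using n by (simp add: h_def \<mu>_def sum_subtractf sum_constant_scaleR flip: scaleR_sum_right)
    then have "measure_pmf.expectation sampling (\<lambda>S. (norm ((minibatch_estimate x y x' S - z) $ i))\<^sup>2)
        = (norm ?w)\<^sup>2 + real b * ((\<Sum>j\<in>{1..n}. (norm (h j))\<^sup>2) / real n)"
      unfolding estimate using n
      by (subst expectation_square_independent_sum) auto
    also have "(\<Sum>j\<in>{1..n}. (norm (h j))\<^sup>2) \<le> 1 / (real b)\<^sup>2 * (\<Sum>j\<in>{1..n}. (norm (\<delta> j))\<^sup>2)"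
    proof -
      have "(\<Sum>j\<in>{1..n}. (norm (\<delta> j - \<mu>))\<^sup>2) \<le> (\<Sum>j\<in>{1..n}. (norm (\<delta> j))\<^sup>2)"
        using sum_square_deviation[of "{1..n}" \<delta>] n by (simp add: \<mu>_def)
      then show ?thesis
        by (simp add: h_def power_mult_distrib power_divide divide_right_mono flip: sum_distrib_left sum_divide_distrib)
    qed
    also have "real b * (1 / (real b)\<^sup>2 * (\<Sum>j\<in>{1..n}. (norm (\<delta> j))\<^sup>2) / real n)
        = 1 / real b * (1 / real n * (\<Sum>j=1..n. (norm (\<delta> j))\<^sup>2))"
      using b by (simp add: power2_eq_square)
    also have "\<dots> \<le> 1 / real b * (Lh\<^sup>2 * (norm (x' $ i - x $ i))\<^sup>2)"
      using average_smooth[of i] xi by (intro mult_left_mono) (auto simp: avg_smooth_def \<delta>_def)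
    finally show ?thesis by (simp add: divide_right_mono mult_left_mono)
  qed
  have "measure_pmf.expectation sampling (\<lambda>S. (norm (minibatch_estimate x y x' S - z))\<^sup>2)
      = (\<Sum>i\<in>UNIV. measure_pmf.expectation sampling (\<lambda>S. (norm ((minibatch_estimate x y x' S - z) $ i))\<^sup>2))"
    unfolding norm_vec_square
    by (intro Bochner_Integration.integral_sum integrable_measure_pmf_finite finite_sampling)
  also have "\<dots> \<le> (\<Sum>i\<in>UNIV. (norm ((y + (G x' - G x) - z) $ i))\<^sup>2 + Lh\<^sup>2 / real b * (norm ((x' - x) $ i))\<^sup>2)"
    by (intro sum_mono node)
  finally show ?thesis
    by (simp add: norm_vec_square sum.distrib sum_distrib_left sum_divide_distrib)
qed

text \<open>
  The error at the next iterate, averaged over coin and samples: it vanishes when the full gradient is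
  taken, so only the minibatch branch, of weight \<open>1 - p\<close>, contributes.
\<close>

lemma page_tracking_error:
  assumes "x \<in> Rn_stack d" "x' \<in> Rn_stack d"
  shows "(1 - p) * measure_pmf.expectation sampling (\<lambda>S. (norm (minibatch_estimate x y x' S - G x'))\<^sup>2)
    \<le> (1 - p) * (norm (y - G x))\<^sup>2 + p * \<Lambda>\<^sup>2 * (norm (x' - x))\<^sup>2"
proof -
  have "(1 - p) * measure_pmf.expectation sampling (\<lambda>S. (norm (minibatch_estimate x y x' S - G x'))\<^sup>2)
      \<le> (1 - p) * ((norm (y - G x))\<^sup>2 + Lh\<^sup>2 / real b * (norm (x' - x))\<^sup>2)"
    using minibatch_error[OF assms, of y "G x'"] p by (intro mult_left_mono) (simp_all add: algebra_simps)
  also have "\<dots> = (1 - p) * (norm (y - G x))\<^sup>2 + ((1 - p) * Lh\<^sup>2 / real b) * (norm (x' - x))\<^sup>2"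
    by (simp add: algebra_simps)
  also have "\<dots> \<le> (1 - p) * (norm (y - G x))\<^sup>2 + (p * \<Lambda>\<^sup>2) * (norm (x' - x))\<^sup>2"
    by (intro add_left_mono mult_right_mono batch_size) simp
  finally show ?thesis .
qed

text \<open>
  It matters that the old error enters with the factor \<open>p\<close>: in the minibatch branch the increment does
  not see the error at all, and the potential gives the error a weight of order \<open>1 / p\<close>.
\<close>

lemma page_increment:
  assumes "x \<in> Rn_stack d" "x' \<in> Rn_stack d"
  shows "p * (norm (G x' - y))\<^sup>2
      + (1 - p) * measure_pmf.expectation sampling (\<lambda>S. (norm (minibatch_estimate x y x' S - y))\<^sup>2)
    \<le> 2 * p * (norm (y - G x))\<^sup>2 + 3 * \<Lambda>\<^sup>2 * (norm (x' - x))\<^sup>2"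
proof -
  let ?D = "(norm (x' - x))\<^sup>2" and ?A = "(norm (y - G x))\<^sup>2"
  have lip: "(norm (G x' - G x))\<^sup>2 \<le> \<Lambda>\<^sup>2 * ?D" by (rule G_lipschitz[OF assms])
  have "(norm (G x' - y))\<^sup>2 \<le> 2 * (\<Lambda>\<^sup>2 * ?D) + 2 * ?A"
    using norm_diff_square_le2[of "G x' - G x" "y - G x"] lip by simp
  then have full: "p * (norm (G x' - y))\<^sup>2 \<le> p * (2 * (\<Lambda>\<^sup>2 * ?D) + 2 * ?A)"
    using p by (intro mult_left_mono) auto
  have "(1 - p) * measure_pmf.expectation sampling (\<lambda>S. (norm (minibatch_estimate x y x' S - y))\<^sup>2)
      \<le> (1 - p) * (\<Lambda>\<^sup>2 * ?D + Lh\<^sup>2 / real b * ?D)"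
    using minibatch_error[OF assms, of y y] lip p by (intro mult_left_mono) (auto intro: order_trans)
  also have "\<dots> = (1 - p) * (\<Lambda>\<^sup>2 * ?D) + ((1 - p) * Lh\<^sup>2 / real b) * ?D"
    by (simp add: algebra_simps)
  also have "\<dots> \<le> (1 - p) * (\<Lambda>\<^sup>2 * ?D) + (p * \<Lambda>\<^sup>2) * ?D"
    by (intro add_left_mono mult_right_mono batch_size) simp
  finally have mini: "(1 - p) * measure_pmf.expectation sampling (\<lambda>S. (norm (minibatch_estimate x y x' S - y))\<^sup>2)
      \<le> (1 - p) * (\<Lambda>\<^sup>2 * ?D) + (p * \<Lambda>\<^sup>2) * ?D" .
  have "p * (\<Lambda>\<^sup>2 * ?D) \<le> 1 * (\<Lambda>\<^sup>2 * ?D)"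
    using p by (intro mult_right_mono) auto
  with full mini show ?thesis by (simp add: algebra_simps)
qed

section \<open>One iteration decreases the potential\<close>

definition next_state ::
  "real ^ 'm ^ 'm \<Rightarrow> real \<Rightarrow> 'm gt_state \<Rightarrow> ('m \<times> nat \<Rightarrow> nat) \<Rightarrow> bool \<Rightarrow> 'm gt_state" where
  "next_state W \<eta> s S coin =
     (let x' = kron_apply (mat 1 - W) (gt_x s) - \<eta> *\<^sub>R gt_v s;
          y' = (if coin then G x' else minibatch_estimate (gt_x s) (gt_y s) x' S)
      in \<lparr>gt_x = x', gt_y = y', gt_v = kron_apply (mat 1 - W) (gt_v s) + y' - gt_y s,
          gt_calls = gt_calls s + 2 * b + (if coin then n else 0)\<rparr>)"

lemma gt_page_step_eq:
  "gt_page_step d n f W \<eta> b p s = bind_pmf sampling (\<lambda>S. map_pmf (next_state W \<eta> s S) (bernoulli_pmf p))"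
  unfolding gt_page_step_def next_state_def minibatch_estimate_def Let_def map_pmf_def ..

lemma expectation_gt_page_step:
  fixes h :: "'m gt_state \<Rightarrow> real"
  shows "measure_pmf.expectation (gt_page_step d n f W \<eta> b p s) h =
    measure_pmf.expectation sampling
      (\<lambda>S. p * h (next_state W \<eta> s S True) + (1 - p) * h (next_state W \<eta> s S False))"
  unfolding gt_page_step_eq using p
  by (subst expectation_bind_finite[OF finite_sampling]) (auto simp: mult.commute)

lemma finite_gt_page_step: "finite (set_pmf (gt_page_step d n f W \<eta> b p s))"
  unfolding gt_page_step_eq set_bind_pmf set_map_pmf
  by (intro finite_UN_I finite_sampling finite_imageI finite)

lemma finite_gt_page: "finite (set_pmf (gt_page d n f W \<eta> b p x0 k))"
  by (induction k) (simp_all add: finite_gt_page_step)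

text \<open>
  The equality of means is the point of gradient tracking: the average descent direction is exactly the
  average of the gradient estimators.
\<close>

definition valid_state :: "'m gt_state \<Rightarrow> bool" where
  "valid_state s \<longleftrightarrow> gt_x s \<in> Rn_stack d \<and> gt_y s \<in> Rn_stack d \<and> gt_v s \<in> Rn_stack d \<and>
     node_mean (gt_v s) = node_mean (gt_y s)"

lemma valid_step:
  assumes "valid_state s" "mixing d \<rho> (mat 1 - W)" "s' \<in> set_pmf (gt_page_step d n f W \<eta> b p s)"
  shows "valid_state s'"
proof -
  from assms(3) obtain S coin where S: "S \<in> set_pmf sampling" and s': "s' = next_state W \<eta> s S coin"
    by (auto simp: gt_page_step_eq)
  have "kron_apply (mat 1 - W) (gt_x s) - \<eta> *\<^sub>R gt_v s \<in> Rn_stack d"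
    using assms(1) by (auto simp: valid_state_def intro!: Rn_stack_closed kron_apply_Rn_stack)
  with assms(1,2) S show ?thesis
    by (auto simp: s' valid_state_def next_state_def Let_def mixing_def node_mean_add node_mean_diff
        intro!: Rn_stack_closed kron_apply_Rn_stack G_Rn_stack minibatch_Rn_stack)
qed

lemma valid_gt_page:
  assumes "x0 \<in> Rn d" "\<And>k. mixing d \<rho> (mat 1 - W k)" "s \<in> set_pmf (gt_page d n f W \<eta> b p x0 k)"
  shows "valid_state s"
  using assms(3)
proof (induction k arbitrary: s)
  case 0
  have "(\<chi> i. x0) \<in> Rn_stack d" using assms(1) by (simp add: Rn_stack_def)
  moreover from this have G: "G (\<chi> i. x0) \<in> Rn_stack d" by (rule G_Rn_stack)
  moreover have "(\<chi> i. node_mean (G (\<chi> i. x0))) \<in> Rn_stack d"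
    using node_mean_Rn[OF G] by (simp add: Rn_stack_def)
  ultimately show ?case
    using 0 by (simp add: valid_state_def gt_page_init_def Let_def node_mean_const)
next
  case (Suc k)
  then obtain t where "t \<in> set_pmf (gt_page d n f W \<eta> b p x0 k)" "s \<in> set_pmf (gt_page_step d n f (W k) \<eta> b p t)"
    by auto
  then show ?case using valid_step[OF Suc.IH assms(2)] by blast
qed

definition mean_grad :: "rvec \<Rightarrow> rvec" where
  "mean_grad u = (1 / real CARD('m)) *\<^sub>R grad d F u"

definition step_size :: real where
  "step_size = 1 / (80 * \<Lambda>)"

text \<open>
  The objective per node plus penalties for the estimator error and for the two consensus errors. The
  error decays at rate \<open>p\<close> only, hence its weight \<open>7 / p\<close>. The numbers are chosen backwards: \<open>7\<close> pays for the
  error's contribution \<open>1\<close> to the descent and \<open>6\<close> to the tracking variable; the squared movement then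
  enters with coefficient \<open>7 + 9 = 16\<close>, so a squared disagreement in \<open>x\<close> costs \<open>1 + 8 * 16\<close>, and \<open>516\<close> is
  four times that because the disagreement loses only a quarter per iteration; and the step size is small enough for the
  feedback of the direction \<open>v\<close> into the other terms to be absorbed by its own contraction.
\<close>

definition potential :: "'m gt_state \<Rightarrow> real" where
  "potential s = F (node_mean (gt_x s)) / real CARD('m)
     + step_size / real CARD('m) * (7 / p * (norm (gt_y s - G (gt_x s)))\<^sup>2
         + 516 * \<Lambda>\<^sup>2 * (norm (dev (gt_x s)))\<^sup>2 + (norm (dev (gt_v s)))\<^sup>2)"

text \<open>
  The mean of \<open>y\<close> differs from the mean gradient at the average point for two reasons: the estimators are
  inaccurate, and each node evaluates its gradient at its own copy instead of the average.
\<close>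

lemma mean_direction_error:
  assumes "x \<in> Rn_stack d"
  shows "(norm (node_mean y - mean_grad (node_mean x)))\<^sup>2
    \<le> 2 / real CARD('m) * ((norm (y - G x))\<^sup>2 + \<Lambda>\<^sup>2 * (norm (dev x))\<^sup>2)"
proof -
  let ?c = "\<chi> i. node_mean x" and ?m = "real CARD('m)"
  have c: "?c \<in> Rn_stack d" using assms by (simp add: Rn_stack_iff node_mean_Rn)
  have "mean_grad (node_mean x) = node_mean (G ?c)"
    unfolding node_mean_def[of "G ?c"]
    using assms by (simp add: mean_grad_def grad_obj node_mean_Rn full_grad_def)
  then have "node_mean y - mean_grad (node_mean x) = node_mean (y - G ?c)"
    by (simp add: node_mean_diff)
  moreover have "?m * (norm (node_mean (y - G ?c)))\<^sup>2 \<le> (norm (y - G ?c))\<^sup>2"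
    using norm_square_dev_mean[of "y - G ?c"] by simp
  moreover have "(norm (y - G ?c))\<^sup>2 \<le> 2 * (norm (y - G x))\<^sup>2 + 2 * (norm (G x - G ?c))\<^sup>2"
    using norm_add_square_le2[of "y - G x" "G x - G ?c"] by simp
  moreover have "(norm (G x - G ?c))\<^sup>2 \<le> \<Lambda>\<^sup>2 * (norm (dev x))\<^sup>2"
    using G_lipschitz[OF c assms] by (simp add: dev_def)
  ultimately have "?m * (norm (node_mean y - mean_grad (node_mean x)))\<^sup>2
      \<le> 2 * ((norm (y - G x))\<^sup>2 + \<Lambda>\<^sup>2 * (norm (dev x))\<^sup>2)"
    by simp
  then show ?thesis by (simp add: field_simps)
qed

text \<open>
  The descent inequality with a perturbed direction \<open>w\<close>, after polarization of the inner product. It is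
  divided by the number of nodes so that the smoothness constant is \<open>\<Lambda>\<close>.
\<close>

lemma mean_descent:
  assumes u: "u \<in> Rn d" and w: "w \<in> Rn d"
  shows "F (u - \<eta> *\<^sub>R w) / real CARD('m) \<le> F u / real CARD('m) - \<eta> / 2 * (norm (mean_grad u))\<^sup>2
    - \<eta> / 2 * (1 - \<Lambda> * \<eta>) * (norm w)\<^sup>2 + \<eta> / 2 * (norm (w - mean_grad u))\<^sup>2"
proof -
  let ?m = "real CARD('m)"
  have m: "?m > 0" by simp
  have "F (u + (- \<eta>) *\<^sub>R w) \<le> F u + inner (grad d F u) ((- \<eta>) *\<^sub>R w) + ?m * \<Lambda> / 2 * (norm ((- \<eta>) *\<^sub>R w))\<^sup>2"
    by (rule L_smooth_descent[OF obj_differentiable obj_smooth u]) (rule Rn_closed w)+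
  also have "inner (grad d F u) ((- \<eta>) *\<^sub>R w) = - ?m * \<eta> * inner (mean_grad u) w"
    by (simp add: mean_grad_def)
  finally have "F (u - \<eta> *\<^sub>R w) \<le> ?m * (F u / ?m - \<eta> * inner (mean_grad u) w + \<Lambda> / 2 * \<eta>\<^sup>2 * (norm w)\<^sup>2)"
    by (simp add: power_mult_distrib algebra_simps)
  then have "F (u - \<eta> *\<^sub>R w) / ?m \<le> F u / ?m - \<eta> * inner (mean_grad u) w + \<Lambda> / 2 * \<eta>\<^sup>2 * (norm w)\<^sup>2"
    using m by (simp add: divide_le_eq mult.commute)
  also have "\<eta> * inner (mean_grad u) w
      = \<eta> / 2 * (norm (mean_grad u))\<^sup>2 + \<eta> / 2 * (norm w)\<^sup>2 - \<eta> / 2 * (norm (w - mean_grad u))\<^sup>2"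
    by (simp add: power2_norm_eq_inner inner_diff_left inner_diff_right inner_commute algebra_simps)
  finally show ?thesis by (simp add: algebra_simps diff_divide_distrib power2_eq_square)
qed

lemma step_size_pos: "step_size > 0"
  using \<Lambda> by (simp add: step_size_def)

lemma step_size_scaling: "step_size\<^sup>2 * \<Lambda>\<^sup>2 = 1 / 6400" "\<Lambda> * step_size = 1 / 80"
  using \<Lambda> by (simp_all add: step_size_def power_divide power_mult_distrib)

text \<open>
  For each outcome of the coin the tracking variable obeys a deterministic recursion; averaging then
  leaves only the two second moments of the estimator.
\<close>

lemma expected_potential_le:
  assumes s: "valid_state s" and W: "mixing d (1 / 2) (mat 1 - W)"
  defines "x' \<equiv> kron_apply (mat 1 - W) (gt_x s) - step_size *\<^sub>R gt_v s"
  shows "measure_pmf.expectation (gt_page_step d n f W step_size b p s) potential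
    \<le> F (node_mean x') / real CARD('m) + step_size / real CARD('m) *
        (7 / p * ((1 - p) * (norm (gt_y s - G (gt_x s)))\<^sup>2 + p * \<Lambda>\<^sup>2 * (norm (x' - gt_x s))\<^sup>2)
         + 516 * \<Lambda>\<^sup>2 * (norm (dev x'))\<^sup>2 + 3 / 4 * (norm (dev (gt_v s)))\<^sup>2
         + 3 * (2 * p * (norm (gt_y s - G (gt_x s)))\<^sup>2 + 3 * \<Lambda>\<^sup>2 * (norm (x' - gt_x s))\<^sup>2))"
proof -
  let ?x = "gt_x s" and ?y = "gt_y s" and ?v = "gt_v s" and ?P = "mat 1 - W" and ?m = "real CARD('m)"
  let ?est = "minibatch_estimate ?x ?y x'"
  let ?c = "step_size / ?m"
  have x: "?x \<in> Rn_stack d" and v: "?v \<in> Rn_stack d" using s by (auto simp: valid_state_def)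
  have x': "x' \<in> Rn_stack d"
    unfolding x'_def by (intro Rn_stack_closed kron_apply_Rn_stack x v)
  have c: "?c \<ge> 0" using step_size_pos by simp
  define B where "B = F (node_mean x') / ?m
    + ?c * (516 * \<Lambda>\<^sup>2 * (norm (dev x'))\<^sup>2 + 3 / 4 * (norm (dev ?v))\<^sup>2)"
  \<comment> \<open>In either branch the new tracking variable is the mixed old one, perturbed by the increment
    \<open>z - y\<close> of the estimator.\<close>
  have tracker: "(norm (dev (kron_apply ?P ?v + z - ?y)))\<^sup>2 \<le> 3 / 4 * (norm (dev ?v))\<^sup>2 + 3 * (norm (z - ?y))\<^sup>2" for z
    using mixing_perturbed[OF W v, of "z - ?y"] norm_dev_le[of "z - ?y"]
    unfolding add_diff_eq by linarith
  have bound: "potential (next_state W step_size s S coin)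
      \<le> B + ?c * (7 / p * (norm (y' - G x'))\<^sup>2 + 3 * (norm (y' - ?y))\<^sup>2)"
    if "y' = (if coin then G x' else ?est S)" for S coin y'
  proof -
    have "potential (next_state W step_size s S coin) = F (node_mean x') / ?m
        + ?c * (7 / p * (norm (y' - G x'))\<^sup>2 + 516 * \<Lambda>\<^sup>2 * (norm (dev x'))\<^sup>2
          + (norm (dev (kron_apply ?P ?v + y' - ?y)))\<^sup>2)"
      using that by (simp add: potential_def next_state_def Let_def x'_def[symmetric])
    also have "\<dots> \<le> F (node_mean x') / ?m
        + ?c * (7 / p * (norm (y' - G x'))\<^sup>2 + 516 * \<Lambda>\<^sup>2 * (norm (dev x'))\<^sup>2
          + (3 / 4 * (norm (dev ?v))\<^sup>2 + 3 * (norm (y' - ?y))\<^sup>2))"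
      by (intro add_left_mono mult_left_mono tracker c)
    finally show ?thesis by (simp add: B_def algebra_simps)
  qed
  have full: "potential (next_state W step_size s S True) \<le> B + ?c * (3 * (norm (G x' - ?y))\<^sup>2)" for S
    using bound[of "G x'" True S] by simp
  have mini: "potential (next_state W step_size s S False)
      \<le> B + ?c * (7 / p * (norm (?est S - G x'))\<^sup>2 + 3 * (norm (?est S - ?y))\<^sup>2)" for S
    using bound[of "?est S" False S] by simp
  have "measure_pmf.expectation (gt_page_step d n f W step_size b p s) potential
      \<le> measure_pmf.expectation sampling (\<lambda>S. p * (B + ?c * (3 * (norm (G x' - ?y))\<^sup>2))
          + (1 - p) * (B + ?c * (7 / p * (norm (?est S - G x'))\<^sup>2 + 3 * (norm (?est S - ?y))\<^sup>2)))"
    unfolding expectation_gt_page_step using p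
    by (intro expectation_mono_finite finite_sampling add_mono mult_left_mono full mini) auto
  also have "\<dots> = B + ?c * (7 / p * ((1 - p) * measure_pmf.expectation sampling (\<lambda>S. (norm (?est S - G x'))\<^sup>2))
      + 3 * (p * (norm (G x' - ?y))\<^sup>2
        + (1 - p) * measure_pmf.expectation sampling (\<lambda>S. (norm (?est S - ?y))\<^sup>2)))"
  proof -
    have regroup: "p * (B + ?c * (3 * i0)) + (1 - p) * (B + ?c * (q * e + 3 * i))
        = (B + ?c * (3 * (p * i0))) + ?c * q * (1 - p) * e + ?c * 3 * (1 - p) * i" for q e i i0
      by algebra
    show ?thesis
      unfolding regroup expectation_affine_finite[OF finite_sampling] by algebra
  qed
  also have "\<dots> \<le> B + ?c * (7 / p * ((1 - p) * (norm (?y - G ?x))\<^sup>2 + p * \<Lambda>\<^sup>2 * (norm (x' - ?x))\<^sup>2)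
      + 3 * (2 * p * (norm (?y - G ?x))\<^sup>2 + 3 * \<Lambda>\<^sup>2 * (norm (x' - ?x))\<^sup>2))"
    using p by (intro add_mono mult_left_mono order_refl page_tracking_error page_increment x x' c) auto
  finally show ?thesis by (simp add: B_def algebra_simps)
qed

text \<open>
  With \<open>A\<close>, \<open>X\<close>, \<open>V\<close>, \<open>U\<close>, \<open>D\<close> standing for the scaled errors, movement and direction, all recursions are
  linear, and the weights of the potential make every coefficient but that of the squared gradient
  nonpositive.
\<close>

lemma potential_decrease:
  assumes s: "valid_state s" and W: "mixing d (1 / 2) (mat 1 - W)"
  shows "measure_pmf.expectation (gt_page_step d n f W step_size b p s) potential
    \<le> potential s - step_size / 2 * (norm (mean_grad (node_mean (gt_x s))))\<^sup>2"
proof -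
  let ?x = "gt_x s" and ?y = "gt_y s" and ?v = "gt_v s" and ?P = "mat 1 - W" and ?m = "real CARD('m)"
  let ?c = "step_size / ?m"
  define x' where "x' = kron_apply ?P ?x - step_size *\<^sub>R ?v"
  define X where "X = \<Lambda>\<^sup>2 * (norm (dev ?x))\<^sup>2"
  define X' where "X' = \<Lambda>\<^sup>2 * (norm (dev x'))\<^sup>2"
  define V where "V = (norm (dev ?v))\<^sup>2"
  define U where "U = ?m * (norm (node_mean ?v))\<^sup>2"
  define A where "A = (norm (?y - G ?x))\<^sup>2"
  define D where "D = \<Lambda>\<^sup>2 * (norm (x' - ?x))\<^sup>2"
  define g where "g = (norm (mean_grad (node_mean ?x)))\<^sup>2"
  have x: "?x \<in> Rn_stack d" and v: "?v \<in> Rn_stack d" and mean: "node_mean ?v = node_mean ?y"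
    using s by (auto simp: valid_state_def)
  have c: "?c \<ge> 0" using step_size_pos by simp
  have nonneg: "A \<ge> 0" "U \<ge> 0" "V \<ge> 0" "X \<ge> 0"
    by (simp_all add: A_def U_def V_def X_def)
  \<comment> \<open>The step size converts the direction into a movement: \<open>(\<Lambda> * step_size)\<^sup>2 = 1 / 6400\<close>.\<close>
  have stacked: "\<Lambda>\<^sup>2 * (norm (step_size *\<^sub>R w))\<^sup>2 = (norm w)\<^sup>2 / 6400" for w :: "rvec ^ 'm"
  proof -
    have "\<Lambda>\<^sup>2 * (norm (step_size *\<^sub>R w))\<^sup>2 = (step_size\<^sup>2 * \<Lambda>\<^sup>2) * (norm w)\<^sup>2"
      by (simp add: power_mult_distrib)
    then show ?thesis unfolding step_size_scaling by simp
  qed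
  have spread: "\<Lambda>\<^sup>2 * (r * a + t * c) = r * (\<Lambda>\<^sup>2 * a) + t * (\<Lambda>\<^sup>2 * c)" for r a t c
    by (simp add: algebra_simps)
  have X': "X' \<le> 3 / 4 * X + 3 / 6400 * V"
  proof -
    have "X' \<le> \<Lambda>\<^sup>2 * (3 / 4 * (norm (dev ?x))\<^sup>2 + 3 * (norm (step_size *\<^sub>R dev ?v))\<^sup>2)"
      using mixing_perturbed[OF W x, of "- (step_size *\<^sub>R ?v)"]
      unfolding X'_def x'_def by (intro mult_left_mono) (simp_all add: dev_uminus dev_scaleR)
    then show ?thesis unfolding spread X_def V_def stacked by linarith
  qed
  have D: "D \<le> 8 * X + (V + U) / 3200"
  proof -
    have "D \<le> \<Lambda>\<^sup>2 * (8 * (norm (dev ?x))\<^sup>2 + 2 * (norm (step_size *\<^sub>R ?v))\<^sup>2)"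
      unfolding D_def x'_def by (intro mult_left_mono mixing_displacement[OF W x]) simp
    then show ?thesis
      unfolding spread stacked norm_square_dev_mean[of ?v] X_def V_def U_def by linarith
  qed
  have descent: "F (node_mean x') / ?m \<le> F (node_mean ?x) / ?m - step_size / 2 * g + ?c * (A + X - 79 / 160 * U)"
  proof -
    have "node_mean x' = node_mean ?x - step_size *\<^sub>R node_mean ?v"
      using W by (simp add: x'_def node_mean_diff node_mean_scaleR mixing_def)
    then have "F (node_mean x') / ?m \<le> F (node_mean ?x) / ?m - step_size / 2 * g
        - step_size / 2 * (1 - \<Lambda> * step_size) * (norm (node_mean ?v))\<^sup>2
        + step_size / 2 * (norm (node_mean ?v - mean_grad (node_mean ?x)))\<^sup>2"
      unfolding g_def using mean_descent[OF node_mean_Rn[OF x] node_mean_Rn[OF v], of step_size] by simp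
    moreover have "step_size / 2 * (norm (node_mean ?v - mean_grad (node_mean ?x)))\<^sup>2
        \<le> step_size / 2 * (2 / ?m * (A + X))"
      unfolding mean A_def X_def using step_size_pos by (intro mult_left_mono mean_direction_error x) auto
    moreover have "step_size / 2 * (2 / ?m * (A + X)) = ?c * (A + X)" by (simp add: field_simps)
    moreover have "step_size / 2 * (1 - \<Lambda> * step_size) * (norm (node_mean ?v))\<^sup>2 = ?c * (79 / 160 * U)"
      using step_size_scaling(2) by (simp add: U_def)
    ultimately show ?thesis unfolding right_diff_distrib[of ?c] by linarith
  qed
  have "measure_pmf.expectation (gt_page_step d n f W step_size b p s) potential
      \<le> F (node_mean x') / ?m + ?c * (7 / p * ((1 - p) * A + p * D) + 516 * X' + 3 / 4 * V
          + 3 * (2 * p * A + 3 * D))"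
    using expected_potential_le[OF s W] by (simp add: x'_def A_def D_def X'_def V_def mult.assoc)
  also have "7 / p * ((1 - p) * A + p * D) = 7 / p * A - 7 * A + 7 * D"
    using p by (simp add: field_simps)
  also have "F (node_mean x') / ?m + ?c * (7 / p * A - 7 * A + 7 * D + 516 * X' + 3 / 4 * V + 3 * (2 * p * A + 3 * D))
      \<le> F (node_mean ?x) / ?m - step_size / 2 * g + ?c * (A + X - 79 / 160 * U)
        + ?c * (7 / p * A - 7 * A + 7 * D + 516 * X' + 3 / 4 * V + 3 * (2 * p * A + 3 * D))"
    using descent by simp
  also have "\<dots> = F (node_mean ?x) / ?m - step_size / 2 * g + ?c * ((A + X - 79 / 160 * U)
        + (7 / p * A - 7 * A + 7 * D + 516 * X' + 3 / 4 * V + 3 * (2 * p * A + 3 * D)))"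
    by (simp only: distrib_left add.assoc)
  also have "\<dots> \<le> F (node_mean ?x) / ?m - step_size / 2 * g + ?c * (7 / p * A + 516 * X + V)"
  proof (intro add_left_mono mult_left_mono c)
    have "p * A \<le> A" using p nonneg by (simp add: mult_left_le_one_le)
    \<comment> \<open>The only nonlinear terms are \<open>p * A\<close> and \<open>7 / p * A\<close>; they are replaced by \<open>r\<close> and \<open>R\<close>.\<close>
    have arith: "(A + X - 79 / 160 * U) + (R - 7 * A + 7 * D + 516 * X' + 3 / 4 * V + 3 * (2 * r + 3 * D))
        \<le> R + 516 * X + V" if "r \<le> A" for R r
      using that X' D nonneg by argo
    show "(A + X - 79 / 160 * U) + (7 / p * A - 7 * A + 7 * D + 516 * X' + 3 / 4 * V + 3 * (2 * p * A + 3 * D))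
        \<le> 7 / p * A + 516 * X + V"
      using arith[OF \<open>p * A \<le> A\<close>, of "7 / p * A"] by (simp only: mult.assoc)
  qed
  also have "\<dots> = potential s - step_size / 2 * g"
  proof -
    have "potential s = F (node_mean ?x) / ?m + ?c * (7 / p * A + 516 * X + V)"
      by (simp only: potential_def A_def X_def V_def mult.assoc)
    then show ?thesis by simp
  qed
  finally show ?thesis by (simp only: g_def)
qed

section \<open>Complexity\<close>

lemma potential_telescoping:
  assumes x0: "x0 \<in> Rn d" and W: "\<And>k. mixing d (1 / 2) (mat 1 - W k)"
  defines "law k \<equiv> gt_page d n f W step_size b p x0 k"
  shows "measure_pmf.expectation (law N) potential
    + step_size / 2 * (\<Sum>k<N. measure_pmf.expectation (law k) (\<lambda>s. (norm (mean_grad (node_mean (gt_x s))))\<^sup>2))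
    \<le> F x0 / real CARD('m)"
proof (induction N)
  case 0
  show ?case
    by (simp add: law_def gt_page_init_def Let_def potential_def node_mean_const dev_const)
next
  case (Suc N)
  have "measure_pmf.expectation (law (Suc N)) potential
      = measure_pmf.expectation (law N) (\<lambda>s. measure_pmf.expectation (gt_page_step d n f (W N) step_size b p s) potential)"
    by (simp add: law_def expectation_bind_finite finite_gt_page finite_gt_page_step)
  also have "\<dots> \<le> measure_pmf.expectation (law N)
      (\<lambda>s. potential s - step_size / 2 * (norm (mean_grad (node_mean (gt_x s))))\<^sup>2)"
    using valid_gt_page[OF x0 W]
    by (intro expectation_mono_finite potential_decrease W) (auto simp: law_def finite_gt_page)
  also have "\<dots> = measure_pmf.expectation (law N) potential
      - step_size / 2 * measure_pmf.expectation (law N) (\<lambda>s. (norm (mean_grad (node_mean (gt_x s))))\<^sup>2)"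
    by (simp add: law_def integrable_measure_pmf_finite finite_gt_page)
  finally show ?case using Suc.IH by (simp add: algebra_simps)
qed

text \<open>
  Up to division by the number of nodes, the potential starts at \<open>F x0\<close>, as all penalties vanish
  initially, never has expectation below \<open>l\<close>, and drops in proportion to the squared gradient of each iterate. The output is uniform
  among the iterates, so its expected squared gradient is their average.
\<close>

lemma expected_output_gradient:
  assumes x0: "x0 \<in> Rn d" and W: "\<And>k. mixing d (1 / 2) (mat 1 - W k)"
    and lower: "\<And>u. u \<in> Rn d \<Longrightarrow> l \<le> F u" and N: "N > 0"
  shows "measure_pmf.expectation (gt_page_output d n f W step_size b p x0 N) (\<lambda>u. (norm (grad d F u))\<^sup>2)
    \<le> 160 * real CARD('m) * \<Lambda> * (F x0 - l) / real N"
proof -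
  let ?m = "real CARD('m)" and ?law = "gt_page d n f W step_size b p x0"
  let ?E = "\<lambda>k. measure_pmf.expectation (?law k) (\<lambda>s. (norm (mean_grad (node_mean (gt_x s))))\<^sup>2)"
  have "l / ?m = measure_pmf.expectation (?law N) (\<lambda>_. l / ?m)" by simp
  also have "\<dots> \<le> measure_pmf.expectation (?law N) potential"
  proof (intro expectation_mono_finite finite_gt_page)
    fix s assume "s \<in> set_pmf (?law N)"
    then have "l \<le> F (node_mean (gt_x s))"
      using valid_gt_page[OF x0 W] by (intro lower node_mean_Rn) (auto simp: valid_state_def)
    moreover have "0 \<le> step_size / ?m * (7 / p * (norm (gt_y s - G (gt_x s)))\<^sup>2
         + 516 * \<Lambda>\<^sup>2 * (norm (dev (gt_x s)))\<^sup>2 + (norm (dev (gt_v s)))\<^sup>2)"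
      using p step_size_pos by (intro mult_nonneg_nonneg add_nonneg_nonneg) auto
    ultimately show "l / ?m \<le> potential s"
      unfolding potential_def by (intro add_increasing2 divide_right_mono) auto
  qed
  finally have "step_size / 2 * (\<Sum>k<N. ?E k) \<le> (F x0 - l) / ?m"
    using potential_telescoping[where W = W and N = N, OF x0 W] unfolding diff_divide_distrib by linarith
  then have sum: "(\<Sum>k<N. ?E k) \<le> 160 * \<Lambda> * (F x0 - l) / ?m"
    using \<Lambda> by (simp add: step_size_def field_simps)
  have "measure_pmf.expectation (gt_page_output d n f W step_size b p x0 N) (\<lambda>u. (norm (grad d F u))\<^sup>2)
      = (\<Sum>k<N. measure_pmf.expectation (?law k) (\<lambda>s. (norm (grad d F (node_mean (gt_x s))))\<^sup>2)) / real N"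
    using N by (simp add: gt_page_output_def expectation_bind_finite finite_gt_page integral_pmf_of_set lessThan_empty_iff)
  also have "(\<lambda>s. (norm (grad d F (node_mean (gt_x s))))\<^sup>2) = (\<lambda>s. ?m\<^sup>2 * (norm (mean_grad (node_mean (gt_x s))))\<^sup>2)"
    by (simp add: mean_grad_def power_divide fun_eq_iff)
  also have "(\<Sum>k<N. measure_pmf.expectation (?law k) (\<lambda>s. ?m\<^sup>2 * (norm (mean_grad (node_mean (gt_x s))))\<^sup>2)) / real N
      = ?m\<^sup>2 * (\<Sum>k<N. ?E k) / real N"
    by (simp add: sum_distrib_left)
  also have "\<dots> \<le> ?m\<^sup>2 * (160 * \<Lambda> * (F x0 - l) / ?m) / real N"
    by (intro divide_right_mono mult_left_mono sum) auto
  also have "\<dots> = 160 * ?m * \<Lambda> * (F x0 - l) / real N"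
    by (simp add: power2_eq_square)
  finally show ?thesis .
qed

lemma initial_gradient:
  assumes "x0 \<in> Rn d" "\<And>u. u \<in> Rn d \<Longrightarrow> l \<le> F u"
  shows "(norm (grad d F x0))\<^sup>2 \<le> 2 * real CARD('m) * \<Lambda> * (F x0 - l)"
  using L_smooth_gradient_gap[OF obj_differentiable obj_smooth _ assms] \<Lambda> by simp

lemma expected_oracle_calls:
  "measure_pmf.expectation (gt_page d n f W \<eta> b p x0 N) (\<lambda>s. real (gt_calls s))
    = real n + real N * (2 * real b + p * real n)"
proof (induction N)
  case 0
  show ?case by (simp add: gt_page_init_def Let_def)
next
  case (Suc N)
  have step: "measure_pmf.expectation (gt_page_step d n f (W N) \<eta> b p s) (\<lambda>s. real (gt_calls s))
      = real (gt_calls s) + (2 * real b + p * real n)" for s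
    unfolding expectation_gt_page_step by (simp add: next_state_def Let_def algebra_simps)
  have "measure_pmf.expectation (gt_page d n f W \<eta> b p x0 (Suc N)) (\<lambda>s. real (gt_calls s))
      = measure_pmf.expectation (gt_page d n f W \<eta> b p x0 N) (\<lambda>s. real (gt_calls s) + (2 * real b + p * real n))"
    by (simp add: expectation_bind_finite finite_gt_page finite_gt_page_step step)
  also have "\<dots> = measure_pmf.expectation (gt_page d n f W \<eta> b p x0 N) (\<lambda>s. real (gt_calls s)) + (2 * real b + p * real n)"
    by (simp add: integrable_measure_pmf_finite finite_gt_page)
  finally show ?case using Suc.IH by (simp add: algebra_simps)
qed

text \<open>
  The bound on \<open>N\<close> carries no additive constant, so rounding up is affordable only if the required number of
  iterations is at least one. Otherwise the starting point itself is accurate enough and \<open>N = 0\<close> works.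
\<close>

lemma gt_page_complexity:
  assumes x0: "x0 \<in> Rn d" and W: "\<And>k. mixing d (1 / 2) (mat 1 - W k)"
    and lower: "\<And>u. u \<in> Rn d \<Longrightarrow> l \<le> F u" and eps: "\<epsilon> > 0"
  obtains N where
    "measure_pmf.expectation (gt_page_output d n f W step_size b p x0 N) (\<lambda>u. (norm (grad d F u))\<^sup>2) \<le> \<epsilon>\<^sup>2"
    "real N \<le> 320 * real CARD('m) * \<Lambda> * (F x0 - l) / \<epsilon>\<^sup>2"
proof -
  define K where "K = 160 * real CARD('m) * \<Lambda> * (F x0 - l)"
  have K: "K \<ge> 0" using \<Lambda> lower[OF x0] by (simp add: K_def)
  show ?thesis
  proof (cases "K / \<epsilon>\<^sup>2 < 1")
    case True
    have "(norm (grad d F x0))\<^sup>2 \<le> 2 * real CARD('m) * \<Lambda> * (F x0 - l)"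
      by (rule initial_gradient[OF x0 lower])
    also have "\<dots> = K / 80" by (simp add: K_def)
    also have "\<dots> \<le> \<epsilon>\<^sup>2" using True K eps by (simp add: field_simps)
    finally show ?thesis using K by (intro that[of 0]) (simp_all add: gt_page_output_def K_def)
  next
    case False
    define N where "N = nat \<lceil>K / \<epsilon>\<^sup>2\<rceil>"
    have N: "N > 0" "K / \<epsilon>\<^sup>2 \<le> real N" "real N \<le> 2 * (K / \<epsilon>\<^sup>2)"
      using False unfolding N_def by linarith+
    have "measure_pmf.expectation (gt_page_output d n f W step_size b p x0 N) (\<lambda>u. (norm (grad d F u))\<^sup>2) \<le> K / real N"
      unfolding K_def by (rule expected_output_gradient[OF x0 W lower N(1)])
    also have "\<dots> \<le> \<epsilon>\<^sup>2" using N(1,2) eps by (simp add: field_simps)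
    finally show ?thesis using N(3) by (intro that[of N]) (simp_all add: K_def)
  qed
qed

end

text \<open>
  Rounding \<open>s / L\<close> up to an integer could spoil \<open>b * L \<le> 2 * s\<close> when \<open>s < L\<close>, as then \<open>b = 1\<close>. Replacing \<open>L\<close> by
  \<open>min L s\<close> restores it and keeps the lower bound.
\<close>

lemma batch_size_bounds:
  fixes s L :: real
  assumes "s > 0" "L > 0" "b = nat \<lceil>s / L\<rceil>"
  shows "b \<ge> 1" "s \<le> real b * min L s" "real b * min L s \<le> 2 * s"
proof -
  have q: "s / L > 0" using assms by simp
  then show b: "b \<ge> 1" unfolding assms(3) by linarith
  have lo: "s / L \<le> real b" and hi: "real b < s / L + 1" using q unfolding assms(3) by linarith+
  show "s \<le> real b * min L s"
    using lo b assms(1,2) by (auto simp: min_def field_simps)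
  show "real b * min L s \<le> 2 * s"
  proof (cases "L \<le> s")
    case True
    with hi assms(1,2) show ?thesis by (simp add: min_def field_simps)
  next
    case False
    with assms have "s / L < 1" by simp
    with hi have "real b < 2" by linarith
    with False assms(1,2) show ?thesis by (simp add: min_def)
  qed
qed

theorem corollary4p5:
  shows "\<exists>C>0. \<forall>(n::nat) (chi::real) (L::real) (Lh::real) (b::nat) (p::real) (T::nat).
    n \<ge> 1 \<and> chi \<ge> 1 \<and> L > 0 \<and> Lh > 0 \<and>
    b = nat \<lceil>sqrt (real n) * Lh / L\<rceil> \<and> p = real b / (real n + real b) \<and> T = nat \<lceil>chi\<rceil> \<longrightarrow>
    (\<exists>\<eta>>0. \<forall>(d::nat) (f :: 'm::finite \<Rightarrow> nat \<Rightarrow> rvec \<Rightarrow> real)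
        (E :: nat \<Rightarrow> ('m \<times> 'm) set) (W :: nat \<Rightarrow> real ^ 'm ^ 'm) (x0::rvec) (\<Delta>::real) (\<epsilon>::real).
      (\<forall>i. \<forall>j\<in>{1..n}. f i j differentiable_on Rn d) \<and>
      (\<forall>i. L_smooth d L (node_obj n f i)) \<and>
      (\<forall>i. avg_smooth d n Lh (f i)) \<and>
      gossip d chi E W \<and>
      bdd_below (obj n f ` Rn d) \<and>
      x0 \<in> Rn d \<and>
      \<Delta> = obj n f x0 - (INF x\<in>Rn d. obj n f x) \<and>
      \<epsilon> > 0 \<longrightarrow>
      (\<exists>N::nat.
        measure_pmf.expectation (gt_page_output d n f (multi_stage W T) \<eta> b p x0 N)
          (\<lambda>x. (norm (grad d (obj n f) x))\<^sup>2) \<le> \<epsilon>\<^sup>2 \<and>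
        measure_pmf.expectation (gt_page d n f (multi_stage W T) \<eta> b p x0 N)
          (\<lambda>s. real (gt_calls s)) \<le> C * (real n + sqrt (real n) * Lh * \<Delta> / \<epsilon>\<^sup>2) \<and>
        real (N * T) \<le> C * (chi * L * \<Delta> / \<epsilon>\<^sup>2)))"
proof (rule exI[of _ "1920 * real CARD('m)"], intro conjI allI impI)
  show "0 < 1920 * real CARD('m)" by simp
next
  fix n b T :: nat and chi L Lh p :: real
  assume "n \<ge> 1 \<and> chi \<ge> 1 \<and> L > 0 \<and> Lh > 0 \<and>
    b = nat \<lceil>sqrt (real n) * Lh / L\<rceil> \<and> p = real b / (real n + real b) \<and> T = nat \<lceil>chi\<rceil>"
  then have n: "n \<ge> 1" and chi: "chi \<ge> 1" and L: "L > 0" and Lh: "Lh > 0"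
    and b_def: "b = nat \<lceil>sqrt (real n) * Lh / L\<rceil>" and p_def: "p = real b / (real n + real b)"
    and T: "T = nat \<lceil>chi\<rceil>" by auto
  define s where "s = sqrt (real n) * Lh"
  \<comment> \<open>\<open>s \<ge> Lh\<close> is also a smoothness constant, and for a very large \<open>L\<close> only \<open>min L s\<close> yields the bound
    on oracle calls: the batch size cannot fall below one, so the number of iterations must not grow with \<open>L\<close>.\<close>
  define \<Lambda> where "\<Lambda> = min L s"
  let ?m = "real CARD('m)"
  let ?C = "1920 * ?m"
  have s: "s > 0" using n Lh by (simp add: s_def)
  have \<Lambda>_pos: "\<Lambda> > 0" and \<Lambda>_le: "\<Lambda> \<le> L" using L s by (auto simp: \<Lambda>_def)
  have bounds: "b \<ge> 1" "s \<le> real b * \<Lambda>" "real b * \<Lambda> \<le> 2 * s"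
    using batch_size_bounds[OF s L, of b] b_def unfolding \<Lambda>_def s_def by simp_all
  have p: "0 < p" "p \<le> 1" using bounds(1) by (simp_all add: p_def)
  have pn: "p * real n \<le> real b"
    using n by (simp add: p_def field_simps)
  have batch: "(1 - p) * Lh\<^sup>2 / real b \<le> p * \<Lambda>\<^sup>2"
  proof -
    have "real n * Lh\<^sup>2 = s\<^sup>2" by (simp add: s_def power_mult_distrib)
    also have "\<dots> \<le> (real b * \<Lambda>)\<^sup>2" using bounds(2) s by (intro power_mono) auto
    finally have *: "real n * Lh\<^sup>2 \<le> real b * (real b * \<Lambda>\<^sup>2)"
      by (simp add: power_mult_distrib power2_eq_square algebra_simps)
    have "1 - p = real n / (real n + real b)" using n by (simp add: p_def field_simps)
    then have "(1 - p) * Lh\<^sup>2 / real b = real n * Lh\<^sup>2 / real b / (real n + real b)"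
      by (simp add: divide_divide_eq_left mult.commute)
    also have "\<dots> \<le> real b * \<Lambda>\<^sup>2 / (real n + real b)"
      using * bounds(1) by (intro divide_right_mono) (simp_all add: divide_le_eq algebra_simps)
    finally show ?thesis by (simp add: p_def)
  qed
  show "\<exists>\<eta>>0. \<forall>(d::nat) (f :: 'm \<Rightarrow> nat \<Rightarrow> rvec \<Rightarrow> real)
        (E :: nat \<Rightarrow> ('m \<times> 'm) set) (W :: nat \<Rightarrow> real ^ 'm ^ 'm) (x0::rvec) (\<Delta>::real) (\<epsilon>::real).
      (\<forall>i. \<forall>j\<in>{1..n}. f i j differentiable_on Rn d) \<and>
      (\<forall>i. L_smooth d L (node_obj n f i)) \<and>
      (\<forall>i. avg_smooth d n Lh (f i)) \<and>
      gossip d chi E W \<and>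
      bdd_below (obj n f ` Rn d) \<and>
      x0 \<in> Rn d \<and>
      \<Delta> = obj n f x0 - (INF x\<in>Rn d. obj n f x) \<and>
      \<epsilon> > 0 \<longrightarrow>
      (\<exists>N::nat.
        measure_pmf.expectation (gt_page_output d n f (multi_stage W T) \<eta> b p x0 N)
          (\<lambda>x. (norm (grad d (obj n f) x))\<^sup>2) \<le> \<epsilon>\<^sup>2 \<and>
        measure_pmf.expectation (gt_page d n f (multi_stage W T) \<eta> b p x0 N)
          (\<lambda>s. real (gt_calls s)) \<le> ?C * (real n + sqrt (real n) * Lh * \<Delta> / \<epsilon>\<^sup>2) \<and>
        real (N * T) \<le> ?C * (chi * L * \<Delta> / \<epsilon>\<^sup>2))"
  proof (rule exI[of _ "1 / (80 * \<Lambda>)"], intro conjI allI impI)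
    show "0 < 1 / (80 * \<Lambda>)" using \<Lambda>_pos by simp
  next
    fix d :: nat and f :: "'m \<Rightarrow> nat \<Rightarrow> rvec \<Rightarrow> real" and E :: "nat \<Rightarrow> ('m \<times> 'm) set"
      and W :: "nat \<Rightarrow> real ^ 'm ^ 'm" and x0 :: rvec and \<Delta> \<epsilon> :: real
    assume "(\<forall>i. \<forall>j\<in>{1..n}. f i j differentiable_on Rn d) \<and>
      (\<forall>i. L_smooth d L (node_obj n f i)) \<and>
      (\<forall>i. avg_smooth d n Lh (f i)) \<and>
      gossip d chi E W \<and>
      bdd_below (obj n f ` Rn d) \<and>
      x0 \<in> Rn d \<and>
      \<Delta> = obj n f x0 - (INF x\<in>Rn d. obj n f x) \<and>
      \<epsilon> > 0"
    then have diff: "\<And>i j. j \<in> {1..n} \<Longrightarrow> f i j differentiable_on Rn d"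
      and smooth: "\<And>i. L_smooth d L (node_obj n f i)" and avg: "\<And>i. avg_smooth d n Lh (f i)"
      and gossip: "gossip d chi E W" and bdd: "bdd_below (obj n f ` Rn d)" and x0: "x0 \<in> Rn d"
      and \<Delta>: "\<Delta> = obj n f x0 - (INF x\<in>Rn d. obj n f x)" and \<epsilon>: "\<epsilon> > 0" by auto
    have "Lh \<le> s" using n Lh by (simp add: s_def)
    then have smooth_min: "L_smooth d \<Lambda> (node_obj n f i)" for i
      using smooth[of i] L_smooth_mono[OF avg_smooth_imp_L_smooth[where f = f and i = i, OF n diff avg], of s] Lh
      by (auto simp: \<Lambda>_def min_def)
    interpret gt_page_problem d n f \<Lambda> Lh b p
      by unfold_locales (assumption | rule n bounds(1) \<Lambda>_pos p diff smooth_min avg batch)+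
    have step: "1 / (80 * \<Lambda>) = step_size" by (simp add: step_size_def)
    have mix: "mixing d (1 / 2) (mat 1 - multi_stage W T k)" for k
      unfolding T by (rule mixing_multi_stage[OF gossip chi])
    have lower: "(INF x\<in>Rn d. obj n f x) \<le> obj n f u" if "u \<in> Rn d" for u
      using bdd that by (intro cINF_lower)
    have \<Delta>_nonneg: "\<Delta> \<ge> 0" using lower[OF x0] by (simp add: \<Delta>)
    obtain N where accuracy: "measure_pmf.expectation (gt_page_output d n f (multi_stage W T) step_size b p x0 N)
          (\<lambda>x. (norm (grad d (obj n f) x))\<^sup>2) \<le> \<epsilon>\<^sup>2"
      and N: "real N \<le> 320 * ?m * \<Lambda> * \<Delta> / \<epsilon>\<^sup>2"
      unfolding \<Delta>
      by (rule gt_page_complexity[where W = "multi_stage W T" and l = "INF x\<in>Rn d. obj n f x",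
            OF x0 mix lower \<epsilon>])
    \<comment> \<open>The choice of \<open>p\<close> makes full gradients cost at most \<open>b\<close> calls per iteration on average.\<close>
    have "real N * (2 * real b + p * real n) \<le> real N * (3 * real b)"
      using pn by (intro mult_left_mono) auto
    also have "\<dots> \<le> 320 * ?m * \<Lambda> * \<Delta> / \<epsilon>\<^sup>2 * (3 * real b)"
      by (intro mult_right_mono N) simp
    also have "\<dots> = 960 * ?m * (real b * \<Lambda>) * (\<Delta> / \<epsilon>\<^sup>2)" by simp
    also have "\<dots> \<le> 960 * ?m * (2 * s) * (\<Delta> / \<epsilon>\<^sup>2)"
      using bounds(3) \<Delta>_nonneg by (intro mult_right_mono mult_left_mono) auto
    also have "\<dots> = ?C * (s * \<Delta> / \<epsilon>\<^sup>2)" by simp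
    finally have work: "real N * (2 * real b + p * real n) \<le> ?C * (s * \<Delta> / \<epsilon>\<^sup>2)" .
    have "real n * 1 \<le> real n * ?C"
      by (intro mult_left_mono) (auto simp: Suc_le_eq intro: order_trans[of _ "real CARD('m)"])
    with work have calls: "measure_pmf.expectation (gt_page d n f (multi_stage W T) step_size b p x0 N)
          (\<lambda>s. real (gt_calls s)) \<le> ?C * (real n + sqrt (real n) * Lh * \<Delta> / \<epsilon>\<^sup>2)"
      unfolding expected_oracle_calls s_def by (simp add: algebra_simps)
    have "real T \<le> 2 * chi" unfolding T using chi by linarith
    then have "real (N * T) \<le> 320 * ?m * \<Lambda> * \<Delta> / \<epsilon>\<^sup>2 * (2 * chi)"
      using N unfolding of_nat_mult by (intro mult_mono) auto
    also have "\<dots> = 640 * ?m * (chi * \<Lambda> * \<Delta> / \<epsilon>\<^sup>2)" by simp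
    also have "\<dots> \<le> ?C * (chi * L * \<Delta> / \<epsilon>\<^sup>2)"
      using \<Lambda>_pos \<Lambda>_le chi \<Delta>_nonneg by (intro mult_mono divide_right_mono) auto
    finally have comms: "real (N * T) \<le> ?C * (chi * L * \<Delta> / \<epsilon>\<^sup>2)" .
    show "\<exists>N::nat.
        measure_pmf.expectation (gt_page_output d n f (multi_stage W T) (1 / (80 * \<Lambda>)) b p x0 N)
          (\<lambda>x. (norm (grad d (obj n f) x))\<^sup>2) \<le> \<epsilon>\<^sup>2 \<and>
        measure_pmf.expectation (gt_page d n f (multi_stage W T) (1 / (80 * \<Lambda>)) b p x0 N)
          (\<lambda>s. real (gt_calls s)) \<le> ?C * (real n + sqrt (real n) * Lh * \<Delta> / \<epsilon>\<^sup>2) \<and>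
        real (N * T) \<le> ?C * (chi * L * \<Delta> / \<epsilon>\<^sup>2)"
      unfolding step using accuracy calls comms by blast
  qed
qed

end
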